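(* Let $k>1$ be an integer and let $q$ be a power of an odd prime $p$. Put $$\tau(k)=\frac{(k+1)(k+2)\left(1+(-1)^k(2k+3)\right)}{24}.$$ If the map $Q_{A_2}^k:\mathbf{F}_q^2\to\mathbf{F}_q^2$ is a permutation, then $p<|\tau(k)|+1$. Moreover, $Q_{A_2}^k$ is not arithmetically exceptional.
   Context: $\mathbf{F}_q$ is the finite field with $q$ elements. A polynomial mapping $f$ in $n$ variables with $n$ components in $\mathbf{Z}[x_1,\dots,x_n]$ is called arithmetically exceptional if the induced map $f:\mathbf{F}_p^n\to\mathbf{F}_p^n$ is a permutation for infinitely many primes $p$. Generalized Chebyshev polynomials of the second kind for $A_2$: let $\Lambda$ be the free abelian group on the fundamental weights $\omega_1,\omega_2$ of the root system $A_2$, with group ring $\mathbf{Z}[\Lambda]$ with basis $\{e^\lambda:\lambda\in\Lambda\}$. The Weyl group $W$ (of order 6) acts on $\Lambda$ and is generated by the reflections $s_1:\omega_1\mapsto-\omega_1+\omega_2,\ \omega_2\mapsto\omega_2$ and $s_2:\omega_1\mapsto\omega_1,\ \omega_2\mapsto\omega_1-\omega_2$. Put $J(x)=\sum_{w\in W}\det(w)\,w(x)$ for $x\in\mathbf{Z}[\Lambda]$, $\rho=\omega_1+\omega_2$, and $\chi_\lambda=J(e^{\rho+\lambda})/J(e^\rho)$. The ring $\mathbf{Z}[\Lambda]^W$ of invariants is the polynomial ring over $\mathbf{Z}$ in $y_1=\chi_{\omega_1}=e^{\omega_1}+e^{-\omega_1+\omega_2}+e^{-\omega_2}$ and $y_2=\chi_{\omega_2}=e^{-\omega_1}+e^{\omega_1-\omega_2}+e^{\omega_2}$.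 For $k\ge 0$, $Q_{A_2}^k$ is the unique pair of polynomials in $\mathbf{Z}[y_1,y_2]$ with $Q_{A_2}^k(y_1,y_2)=(\chi_{k\omega_1},\chi_{k\omega_2})$. Equivalently, $Q_{A_2}^k(y_1,y_2)=(h_k(y_1,y_2),h_k(y_2,y_1))$ where $h_0=1$, $h_1=y_1$, $h_2=y_1^2-y_2$ and $h_k=y_1h_{k-1}-y_2h_{k-2}+h_{k-3}$ for $k\ge3$. The map on $\mathbf{F}_q^2$ is obtained by reducing the integer coefficients modulo $p$. *)

theory Defs
  imports
    Complex_Main
    "HOL-Library.Poly_Mapping"
    "HOL-Library.Product_Plus"
    "HOL-Algebra.Ring"
    "HOL-Algebra.Coset"
    "HOL-Number_Theory.Residues"
begin

text \<open>
  The weight \<open>a \<omega>\<^sub>1 + b \<omega>\<^sub>2\<close> of the root system \<open>A\<^sub>2\<close> is represented by the pair \<open>(a, b)\<close>.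
  Its group ring is the ring of finitely supported functions with the convolution product.
\<close>

type_synonym weight = "int \<times> int"

type_synonym weight_ring = "weight \<Rightarrow>\<^sub>0 int"

definition e_pow :: "weight \<Rightarrow> weight_ring" where
  "e_pow lam = Poly_Mapping.single lam 1"

text \<open>The linear extensions of
  \<open>\<omega>\<^sub>1 \<mapsto> -\<omega>\<^sub>1 + \<omega>\<^sub>2, \<omega>\<^sub>2 \<mapsto> \<omega>\<^sub>2\<close> and of
  \<open>\<omega>\<^sub>1 \<mapsto> \<omega>\<^sub>1, \<omega>\<^sub>2 \<mapsto> \<omega>\<^sub>1 - \<omega>\<^sub>2\<close>.\<close>

definition refl1 :: "weight \<Rightarrow> weight" where
  "refl1 = (\<lambda>(a, b). (- a, a + b))"

definition refl2 :: "weight \<Rightarrow> weight" where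
  "refl2 = (\<lambda>(a, b). (a + b, - b))"

text \<open>The generators are involutions, so closure under inverses is automatic.\<close>

inductive_set weyl_group :: "(weight \<Rightarrow> weight) set" where
  weyl_id: "id \<in> weyl_group"
| weyl_refl1: "w \<in> weyl_group \<Longrightarrow> refl1 \<circ> w \<in> weyl_group"
| weyl_refl2: "w \<in> weyl_group \<Longrightarrow> refl2 \<circ> w \<in> weyl_group"

text \<open>The determinant of an endomorphism of the weight lattice, from its matrix in the basis
  \<open>\<omega>\<^sub>1, \<omega>\<^sub>2\<close>.\<close>

definition weight_det :: "(weight \<Rightarrow> weight) \<Rightarrow> int" where
  "weight_det w = fst (w (1, 0)) * snd (w (0, 1)) - snd (w (1, 0)) * fst (w (0, 1))"

text \<open>The action on the group ring: the additive extension of \<open>e\<^sup>\<lambda> \<mapsto> e\<^sup>w\<^sup>\<lambda>\<close>.\<close>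

definition weight_act :: "(weight \<Rightarrow> weight) \<Rightarrow> weight_ring \<Rightarrow> weight_ring" where
  "weight_act w x =
    (\<Sum>lam\<in>Poly_Mapping.keys x. Poly_Mapping.single (w lam) (Poly_Mapping.lookup x lam))"

definition alt_sum :: "weight_ring \<Rightarrow> weight_ring" where
  "alt_sum x = (\<Sum>w\<in>weyl_group. of_int (weight_det w) * weight_act w x)"

definition weyl_rho :: weight where
  "weyl_rho = (1, 1)"

text \<open>The quotient \<open>J(e\<^sup>\<rho>\<^sup>+\<^sup>\<lambda>) / J(e\<^sup>\<rho>)\<close>, taken in the group ring, which is an integral domain.\<close>

definition weyl_char :: "weight \<Rightarrow> weight_ring" where
  "weyl_char lam =
    (THE x. x * alt_sum (e_pow weyl_rho) = alt_sum (e_pow (weyl_rho + lam)))"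

text \<open>Integer polynomials in two variables: \<open>(i, j)\<close> stands for the monomial with exponent \<open>i\<close>
  in the first and \<open>j\<close> in the second variable.\<close>

type_synonym bipoly = "(nat \<times> nat) \<Rightarrow>\<^sub>0 int"

definition bipoly_eval :: "bipoly \<Rightarrow> 'a::comm_ring_1 \<Rightarrow> 'a \<Rightarrow> 'a" where
  "bipoly_eval P x y =
    (\<Sum>m\<in>Poly_Mapping.keys P. of_int (Poly_Mapping.lookup P m) * x ^ fst m * y ^ snd m)"

definition Q_A2 :: "nat \<Rightarrow> bipoly \<times> bipoly" where
  "Q_A2 k = (THE PQ.
     bipoly_eval (fst PQ) (weyl_char (1, 0)) (weyl_char (0, 1)) = weyl_char (int k, 0) \<and>
     bipoly_eval (snd PQ) (weyl_char (1, 0)) (weyl_char (0, 1)) = weyl_char (0, int k))"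

text \<open>The same evaluation in a ring given by a carrier; the integer coefficients act by integer
  multiples, which in characteristic \<open>p\<close> amounts to reducing them modulo \<open>p\<close>.\<close>

definition bipoly_eval_ring :: "('a, 'b) ring_scheme \<Rightarrow> bipoly \<Rightarrow> 'a \<Rightarrow> 'a \<Rightarrow> 'a" where
  "bipoly_eval_ring R P x y =
    (\<Oplus>\<^bsub>R\<^esub>m\<in>Poly_Mapping.keys P.
       add_pow R (Poly_Mapping.lookup P m) (x [^]\<^bsub>R\<^esub> fst m \<otimes>\<^bsub>R\<^esub> y [^]\<^bsub>R\<^esub> snd m))"

definition induced_map ::
    "('a, 'b) ring_scheme \<Rightarrow> bipoly \<times> bipoly \<Rightarrow> 'a \<times> 'a \<Rightarrow> 'a \<times> 'a" where
  "induced_map R PQ = (\<lambda>(x, y).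
     (bipoly_eval_ring R (fst PQ) x y, bipoly_eval_ring R (snd PQ) x y))"

definition permutes_plane :: "('a, 'b) ring_scheme \<Rightarrow> bipoly \<times> bipoly \<Rightarrow> bool" where
  "permutes_plane R PQ \<longleftrightarrow>
     bij_betw (induced_map R PQ) (carrier R \<times> carrier R) (carrier R \<times> carrier R)"

definition arithmetically_exceptional :: "bipoly \<times> bipoly \<Rightarrow> bool" where
  "arithmetically_exceptional PQ \<longleftrightarrow>
     infinite {p::nat. prime p \<and> permutes_plane (residue_ring (int p)) PQ}"

text \<open>The values need not be integers: \<open>\<tau>(3) = -20/3\<close>.\<close>

definition tau :: "nat \<Rightarrow> real" where
  "tau k = (real k + 1) * (real k + 2) * (1 + (- 1) ^ k * (2 * real k + 3)) / 24"

end

theory Submission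
  imports "HOL-Computational_Algebra.Polynomial" "HOL-Library.Product_Lexorder" Defs
begin

text \<open>
  The map preserves the diagonal \<open>y\<^sub>1 = y\<^sub>2\<close>, and already the restriction to the diagonal fails to be injective when
  \<open>p\<close> is large. Put \<open>y = 1 + x\<close> and \<open>x = a + 1/a\<close>. Then both components are the complete symmetric polynomial of
  \<open>1, a, 1/a\<close>, for which
  \<open>h\<^sub>k(1, a, 1/a) = (a\<^sup>k\<^sup>+\<^sup>1 - 1) (a\<^sup>k\<^sup>+\<^sup>2 - 1) / (a\<^sup>k (a - 1) (a\<^sup>2 - 1))\<close>.
  In terms of the Dickson polynomials \<open>D\<^sub>n(a + 1/a) = a\<^sup>n + a\<^sup>-\<^sup>n\<close>, the restricted map \<open>g\<close>, as a function of \<open>x\<close>,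
  satisfies \<open>g\<^sup>2 (D\<^sub>1 - 2) (D\<^sub>2 - 2) = (D\<^sub>k\<^sub>+\<^sub>1 - 2) (D\<^sub>k\<^sub>+\<^sub>2 - 2)\<close> (\<open>diag_square\<close>). This formula gives no
  information at \<open>x = 2\<close> and \<open>x = -2\<close>, where \<open>a\<close> is \<open>1\<close> or \<open>-1\<close>; the product of the values of \<open>g\<close> at these two points
  is \<open>3 \<tau>(k)\<close>, and \<open>\<tau>(k)\<close> enters in this way.

  Suppose that \<open>g\<close> is injective on the field with \<open>q\<close> elements and \<open>p \<ge> \<bar>\<tau>(k)\<bar> + 1\<close>. Then \<open>p \<ge> 5\<close>, and \<open>g\<close> vanishes
  at neither \<open>2\<close> nor \<open>-2\<close>, but has exactly one zero \<open>x0\<close>. If \<open>x\<close> is a zero then \<open>D\<^sub>2(x)\<close>, which belongs to \<open>a\<^sup>2\<close>, is a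
  zero or one of \<open>2\<close>, \<open>-2\<close>. Hence \<open>x0\<close> is \<open>-1\<close> or \<open>0\<close>, and \<open>a\<close> is a primitive third or fourth root of unity
  (\<open>unique_zero\<close>). That there are no further zeros determines the greatest common divisors of \<open>k + 1\<close> and \<open>k + 2\<close>
  with \<open>q - 1\<close> and \<open>q + 1\<close>, and with their least common multiple, nearly completely (\<open>torsion_of_unique_zero\<close>).

  The elements \<open>x\<close> of the field correspond to the \<open>a\<close> with \<open>a\<^sup>q\<^sup>-\<^sup>1 = 1\<close> or \<open>a\<^sup>q\<^sup>+\<^sup>1 = 1\<close>, so that \<open>D\<^sub>u\<close> permutes the field
  if \<open>u\<close> is prime to \<open>q\<^sup>2 - 1\<close>. Therefore, in a product over all \<open>x\<close> other than \<open>2\<close>, \<open>-2\<close>, \<open>x0\<close>, the indices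
  \<open>k + 1\<close> and \<open>k + 2\<close> may be replaced by the greatest common divisors just mentioned, which are \<open>2\<close>, \<open>3\<close> or \<open>1\<close>, \<open>4\<close>.
  In both cases the product of \<open>g\<^sup>2\<close> becomes that of \<open>(x - x0)\<^sup>2\<close>. But \<open>g(x)\<close> and \<open>x - x0\<close> also have the same product
  over all \<open>x\<close> other than \<open>x0\<close>, since both run through the nonzero elements. Comparison leaves
  \<open>(g(2) g(-2))\<^sup>2 = (4 - x0\<^sup>2)\<^sup>2\<close> in the field (\<open>values_at_special_points\<close>). So \<open>p\<close> divides \<open>9 \<tau>(k)\<^sup>2 - 9\<close> or
  \<open>9 \<tau>(k)\<^sup>2 - 16\<close>, which are not zero. A comparison of sizes excludes this except in one
  borderline case, where \<open>p - 1 = \<bar>\<tau>(k)\<bar>\<close> would contradict the values of the greatest common divisors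
  (\<open>diag_not_injective\<close>).

  The elements \<open>a\<close> lie in a quadratic extension of the field. The argument avoids this extension: whatever concerns
  \<open>a\<close> is expressed by identities between integer polynomials in \<open>x\<close>.
\<close>

section \<open>The recursion for the characters\<close>

text \<open>
  The complete homogeneous symmetric polynomial of degree \<open>n\<close> in three quantities with product \<open>1\<close>,
  written in terms of their elementary symmetric functions \<open>u\<close> and \<open>v\<close>. It is polymorphic because the same
  recursion is followed by characters in the group ring, by polynomials and by the values of polynomials.
\<close>

fun csym :: "'a::comm_ring_1 \<Rightarrow> 'a \<Rightarrow> nat \<Rightarrow> 'a" where
  "csym u v 0 = 1"
| "csym u v (Suc 0) = u"
| "csym u v (Suc (Suc 0)) = u * u - v"
| "csym u v (Suc (Suc (Suc n))) = u * csym u v (Suc (Suc n)) - v * csym u v (Suc n) + csym u v n"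

lemma bipoly_eval_superset:
  assumes "finite S" "Poly_Mapping.keys P \<subseteq> S"
  shows "bipoly_eval P x y =
    (\<Sum>m\<in>S. of_int (Poly_Mapping.lookup P m) * x ^ fst m * y ^ snd m)"
  unfolding bipoly_eval_def using assms
  by (intro sum.mono_neutral_left) (auto simp: in_keys_iff)

lemma bipoly_eval_add: "bipoly_eval (P + Q) x y = bipoly_eval P x y + bipoly_eval Q x y"
proof -
  let ?S = "Poly_Mapping.keys P \<union> Poly_Mapping.keys Q"
  show ?thesis
    using Poly_Mapping.keys_add[of P Q]
    by (simp add: bipoly_eval_superset[of ?S] lookup_add algebra_simps sum.distrib)
qed

lemma bipoly_eval_single:
  "bipoly_eval (Poly_Mapping.single m c) x y = of_int c * x ^ fst m * y ^ snd m"
  by (simp add: bipoly_eval_superset[of "{m}"])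

lemma bipoly_eval_0: "bipoly_eval 0 x y = 0"
  by (simp add: bipoly_eval_def)

lemma bipoly_eval_1: "bipoly_eval 1 x y = 1"
  by (simp add: bipoly_eval_single flip: single_one)

lemma bipoly_eval_diff: "bipoly_eval (P - Q) x y = bipoly_eval P x y - bipoly_eval Q x y"
  using bipoly_eval_add[of "P - Q" Q x y] by simp

lemma poly_mapping_additive_induct [case_names zero single add]:
  fixes x :: "'a \<Rightarrow>\<^sub>0 'b::comm_monoid_add"
  assumes "P 0" "\<And>k v. P (Poly_Mapping.single k v)" "\<And>x y. P x \<Longrightarrow> P y \<Longrightarrow> P (x + y)"
  shows "P x"
proof -
  have "P (\<Sum>k\<in>A. Poly_Mapping.single k (Poly_Mapping.lookup x k))" if "finite A" for A
    using that by induction (auto intro: assms)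
  moreover have "x = (\<Sum>k\<in>Poly_Mapping.keys x. Poly_Mapping.single k (Poly_Mapping.lookup x k))"
    by (rule poly_mapping_eqI)
       (auto simp: lookup_sum lookup_single when_def in_keys_iff)
  ultimately show ?thesis
    by (metis finite_keys)
qed

lemma bipoly_eval_mult: "bipoly_eval (P * Q) x y = bipoly_eval P x y * bipoly_eval Q x y"
proof (induction P rule: poly_mapping_additive_induct)
  case (single m c)
  show ?case
  proof (induction Q rule: poly_mapping_additive_induct)
    case (single m' c')
    show ?case
      by (simp add: mult_single bipoly_eval_single power_add algebra_simps)
  qed (simp_all add: distrib_left bipoly_eval_add bipoly_eval_0)
qed (simp_all add: distrib_right bipoly_eval_add bipoly_eval_0)

lemma bipoly_eval_csym:
  "bipoly_eval (csym A B n) x y = csym (bipoly_eval A x y) (bipoly_eval B x y) n"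
  by (induction A B n rule: csym.induct)
     (simp_all add: bipoly_eval_1 bipoly_eval_add bipoly_eval_diff bipoly_eval_mult)

text \<open>
  With the lexicographic order the weights form a linearly ordered group. Hence the group ring is an
  integral domain, so that division by \<open>J(e\<^sup>\<rho>)\<close> is unambiguous, and leading weights add up under products.
\<close>

instance prod :: (linordered_ab_group_add, linordered_ab_group_add) ordered_cancel_comm_monoid_add
  by standard (auto simp: less_eq_prod_def)

definition has_lead :: "weight_ring \<Rightarrow> weight \<Rightarrow> bool" where
  "has_lead x lam \<longleftrightarrow> Poly_Mapping.lookup x lam = 1 \<and> (\<forall>mu > lam. Poly_Mapping.lookup x mu = 0)"

lemma has_lead_above: "has_lead x lam \<Longrightarrow> lam < mu \<Longrightarrow> Poly_Mapping.lookup x mu = 0"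
  unfolding has_lead_def by blast

lemma lookup_e_pow: "Poly_Mapping.lookup (e_pow lam) mu = (if lam = mu then 1 else 0)"
  by (simp add: e_pow_def lookup_single)

lemma e_pow_mult: "e_pow lam * e_pow mu = e_pow (lam + mu)"
  by (simp add: e_pow_def mult_single)

lemma lookup_const_mult:
  "Poly_Mapping.lookup (of_int c * (x :: weight_ring)) mu = c * Poly_Mapping.lookup x mu"
proof (induction x rule: poly_mapping_additive_induct)
  case (single k v)
  have "(of_int c :: weight_ring) = Poly_Mapping.single 0 c"
    by (metis single_of_int of_int_eq_id id_apply)
  then show ?case
    by (simp add: mult_single lookup_single when_def del: single_of_int)
qed (simp_all add: distrib_left lookup_add)

lemma has_lead_iff_remainder:
  "has_lead x lam \<longleftrightarrow> (\<forall>mu \<in> Poly_Mapping.keys (x - e_pow lam). mu < lam)"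
proof -
  have "(\<forall>mu \<in> Poly_Mapping.keys (x - e_pow lam). mu < lam) \<longleftrightarrow>
    (\<forall>mu. \<not> mu < lam \<longrightarrow> Poly_Mapping.lookup (x - e_pow lam) mu = 0)"
    by (metis in_keys_iff)
  also have "\<dots> \<longleftrightarrow> (\<forall>mu. mu = lam \<or> lam < mu \<longrightarrow> Poly_Mapping.lookup (x - e_pow lam) mu = 0)"
    by (metis not_less_iff_gr_or_eq)
  also have "\<dots> \<longleftrightarrow> has_lead x lam"
    unfolding has_lead_def by (auto simp: lookup_minus lookup_e_pow simp del: split_paired_All)
  finally show ?thesis by simp
qed

text \<open>
  In a product of two elements of the form \<open>e\<^sup>\<lambda>\<close> plus lower terms, every contribution except the product
  of the two leading terms is lower.
\<close>

lemma has_lead_mult: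
  assumes "has_lead x lam" "has_lead y mu"
  shows "has_lead (x * y) (lam + mu)"
proof -
  let ?x = "x - e_pow lam" and ?y = "y - e_pow mu"
  have decomp: "x * y - e_pow (lam + mu) = ?x * y + e_pow lam * ?y"
    unfolding e_pow_mult[symmetric] by (simp add: left_diff_distrib right_diff_distrib)
  have x: "nu < lam" if "nu \<in> Poly_Mapping.keys ?x" for nu
    using that assms(1) by (auto simp: has_lead_iff_remainder)
  have y: "nu < mu" if "nu \<in> Poly_Mapping.keys ?y" for nu
    using that assms(2) by (auto simp: has_lead_iff_remainder)
  have y': "nu \<le> mu" if "nu \<in> Poly_Mapping.keys y" for nu
    using that has_lead_above[OF assms(2), of nu] by (auto simp: in_keys_iff not_less[symmetric])
  have "nu < lam + mu" if nu: "nu \<in> Poly_Mapping.keys (?x * y + e_pow lam * ?y)" for nu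
  proof -
    have "nu \<in> Poly_Mapping.keys (?x * y) \<or> nu \<in> Poly_Mapping.keys (e_pow lam * ?y)"
      using nu Poly_Mapping.keys_add[of "?x * y" "e_pow lam * ?y"] by blast
    then show ?thesis
    proof
      assume "nu \<in> Poly_Mapping.keys (?x * y)"
      then obtain a b where "nu = a + b" "a \<in> Poly_Mapping.keys ?x" "b \<in> Poly_Mapping.keys y"
        using keys_mult[of ?x y] by blast
      then show ?thesis using add_less_le_mono[OF x[of a] y'[of b]] by blast
    next
      assume "nu \<in> Poly_Mapping.keys (e_pow lam * ?y)"
      then obtain a b where "nu = a + b" "a \<in> Poly_Mapping.keys (e_pow lam)"
        "b \<in> Poly_Mapping.keys ?y"
        using keys_mult[of "e_pow lam" ?y] by blast
      then show ?thesis using add_strict_left_mono[OF y[of b], of lam] by (simp add: e_pow_def)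
    qed
  qed
  then show ?thesis
    unfolding has_lead_iff_remainder decomp by blast
qed

lemma has_lead_power:
  assumes "has_lead x (a, b)"
  shows "has_lead (x ^ n) (int n * a, int n * b)"
proof (induction n)
  case 0
  have "has_lead 1 0"
    unfolding has_lead_def lookup_one by (auto simp: when_def simp del: split_paired_All)
  then show ?case by (simp add: zero_prod_def)
next
  case (Suc n)
  have eq: "(a, b) + (int n * a, int n * b) = (int (Suc n) * a, int (Suc n) * b)"
    by (simp add: distrib_right)
  show ?case
    using has_lead_mult[OF assms Suc] by (simp only: eq power_Suc)
qed

definition y1 :: weight_ring where
  "y1 = e_pow (1, 0) + e_pow (-1, 1) + e_pow (0, -1)"

definition y2 :: weight_ring where
  "y2 = e_pow (-1, 0) + e_pow (1, -1) + e_pow (0, 1)"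

text \<open>
  The algebraic independence of the two fundamental characters. The monomial \<open>y\<^sub>1\<^sup>i y\<^sub>2\<^sup>j\<close> has the
  lexicographically largest weight \<open>(i + j, - j)\<close>, from which \<open>i\<close> and \<open>j\<close> can be recovered, so the leading
  terms of different monomials cannot cancel.
\<close>

lemma bipoly_eval_y_eq_0:
  assumes "bipoly_eval P y1 y2 = 0"
  shows "P = 0"
proof (rule ccontr)
  assume "P \<noteq> 0"
  define lead where "lead m = (int (fst m) + int (snd m), - int (snd m))" for m :: "nat \<times> nat"
  have inj: "lead m = lead m' \<longleftrightarrow> m = m'" for m m'
    by (auto simp: lead_def prod_eq_iff)
  have lead: "has_lead (y1 ^ fst m * y2 ^ snd m) (lead m)" for m
  proof -
    have "has_lead y1 (1, 0)" "has_lead y2 (1, -1)"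
      by (auto simp: has_lead_def y1_def y2_def lookup_add lookup_e_pow)
    then show ?thesis
      using has_lead_mult[OF has_lead_power[of y1 1 0 "fst m"] has_lead_power[of y2 1 "-1" "snd m"]]
      by (simp add: lead_def)
  qed
  let ?K = "Poly_Mapping.keys P"
  have fin: "finite (lead ` ?K)" "lead ` ?K \<noteq> {}"
    using \<open>P \<noteq> 0\<close> by auto
  obtain m where m: "m \<in> ?K" "lead m = Max (lead ` ?K)"
    using Max_in[OF fin] by (metis imageE)
  have coeff: "Poly_Mapping.lookup (y1 ^ fst m' * y2 ^ snd m') (lead m) = (if m' = m then 1 else 0)"
    if "m' \<in> ?K" for m'
  proof (cases "m' = m")
    case False
    have "lead m' \<le> lead m"
      using that m fin by simp
    then have "lead m' < lead m"
      using False inj by (simp add: order_less_le)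
    then show ?thesis
      using has_lead_above[OF lead[of m']] False by simp
  qed (use lead[of m] in \<open>simp add: has_lead_def\<close>)
  have "Poly_Mapping.lookup (bipoly_eval P y1 y2) (lead m)
      = (\<Sum>m'\<in>?K. Poly_Mapping.lookup P m' * (if m' = m then 1 else 0))"
    unfolding bipoly_eval_def
    by (simp add: lookup_sum mult.assoc lookup_const_mult coeff cong: sum.cong)
  also have "\<dots> = Poly_Mapping.lookup P m"
    using m(1) by (subst sum.remove[of _ m]) auto
  finally show False
    using assms m(1) by (simp add: in_keys_iff)
qed

lemma weyl_group_eq:
  "weyl_group = {id, refl1, refl2, refl1 \<circ> refl2, refl2 \<circ> refl1, refl1 \<circ> (refl2 \<circ> refl1)}"
  (is "_ = ?W")
proof
  have r: "refl1 (refl1 x) = x" "refl2 (refl2 x) = x"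
    "refl2 (refl1 (refl2 x)) = refl1 (refl2 (refl1 x))" for x
    by (auto simp: refl1_def refl2_def split: prod.splits)
  show "weyl_group \<subseteq> ?W"
  proof
    fix w assume "w \<in> weyl_group"
    then show "w \<in> ?W"
    proof induction
      case weyl_id
      show ?case by simp
    next
      case (weyl_refl1 w)
      then show ?case by (elim insertE emptyE) (simp_all add: r comp_def)
    next
      case (weyl_refl2 w)
      then show ?case by (elim insertE emptyE) (simp_all add: r comp_def)
    qed
  qed
  have "refl1 \<circ> id \<in> weyl_group" "refl2 \<circ> id \<in> weyl_group"
    by (intro weyl_group.intros)+
  then show "?W \<subseteq> weyl_group"
    by (auto intro!: weyl_group.intros)
qed

lemma alt_sum_e_pow:
  "alt_sum (e_pow (a, b)) = e_pow (a, b) - e_pow (- a, a + b) - e_pow (a + b, - b)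
     + e_pow (- a - b, a) + e_pow (b, - a - b) - e_pow (- b, - a)"
proof -
  have act: "weight_act w (e_pow lam) = e_pow (w lam)" for w lam
    by (simp add: weight_act_def e_pow_def)
  have ne: "w \<noteq> w'" if "w (1, 0) \<noteq> w' (1, 0) \<or> w (0, 1) \<noteq> w' (0, 1)" for w w' :: "weight \<Rightarrow> weight"
    using that by auto
  have "distinct [id, refl1, refl2, refl1 \<circ> refl2, refl2 \<circ> refl1, refl1 \<circ> (refl2 \<circ> refl1)]"
    unfolding distinct.simps list.set
    by (intro conjI TrueI; simp only: insert_iff empty_iff de_Morgan_disj not_False_eq_True simp_thms;
        (intro conjI)?; rule ne; simp add: refl1_def refl2_def)
  then have "sum g weyl_group = sum_list (map g
      [id, refl1, refl2, refl1 \<circ> refl2, refl2 \<circ> refl1, refl1 \<circ> (refl2 \<circ> refl1)])" for g :: "_ \<Rightarrow> weight_ring"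
    unfolding weyl_group_eq by (subst sum_list_distinct_conv_sum_set) simp_all
  then show ?thesis
    by (simp add: alt_sum_def act weight_det_def refl1_def refl2_def add.commute)
qed

lemma alt_sum_rho_nonzero: "alt_sum (e_pow weyl_rho) \<noteq> 0"
proof
  assume "alt_sum (e_pow weyl_rho) = 0"
  then have "Poly_Mapping.lookup (alt_sum (e_pow weyl_rho)) (1, 1) = 0"
    by simp
  then show False
    by (simp add: weyl_rho_def alt_sum_e_pow lookup_add lookup_minus lookup_e_pow)
qed

lemma weyl_char_eqI:
  assumes "x * alt_sum (e_pow weyl_rho) = alt_sum (e_pow (weyl_rho + lam))"
  shows "weyl_char lam = x"
  unfolding weyl_char_def
proof (rule the_equality)
  fix z assume "z * alt_sum (e_pow weyl_rho) = alt_sum (e_pow (weyl_rho + lam))"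
  then show "z = x"
    using mult_right_cancel[OF alt_sum_rho_nonzero, of z x] assms by simp
qed (rule assms)

text \<open>
  The set of weights of \<open>y\<^sub>1\<close> is stable under the Weyl group, so multiplying an alternating sum by \<open>y\<^sub>1\<close>
  only shifts its weight by the three weights of \<open>y\<^sub>1\<close>; in the same way for \<open>y\<^sub>2\<close>.
\<close>

lemma y1_alt_sum:
  "y1 * alt_sum (e_pow (a, b)) =
     alt_sum (e_pow (a + 1, b)) + alt_sum (e_pow (a - 1, b + 1)) + alt_sum (e_pow (a, b - 1))"
  unfolding y1_def alt_sum_e_pow
  by (simp add: algebra_simps e_pow_mult)

lemma y2_alt_sum:
  "y2 * alt_sum (e_pow (a, b)) =
     alt_sum (e_pow (a - 1, b)) + alt_sum (e_pow (a + 1, b - 1)) + alt_sum (e_pow (a, b + 1))"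
  unfolding y2_def alt_sum_e_pow
  by (simp add: algebra_simps e_pow_mult)
     (intro arg_cong2[where f = "(+)"] arg_cong[where f = e_pow]; simp)

text \<open>
  A weight fixed by a reflection is reached by elements of both determinants equally often, so that
  its terms cancel.
\<close>

lemma alt_sum_wall: "alt_sum (e_pow (a, 0)) = 0" "alt_sum (e_pow (0, b)) = 0"
  "alt_sum (e_pow (a, - a)) = 0"
  by (simp_all add: alt_sum_e_pow)

text \<open>
  When the recursion is multiplied by \<open>J(e\<^sup>\<rho>)\<close>, the alternating sums that are not on the line
  \<open>\<rho> + \<nat> \<omega>\<^sub>1\<close> cancel in pairs or vanish on a wall.
\<close>

lemma csym_alt_sum1:
  "csym y1 y2 n * alt_sum (e_pow (1, 1)) = alt_sum (e_pow (1 + int n, 1))"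
proof (induction n rule: less_induct)
  case (less n)
  consider "n = 0" | "n = 1" | "n = 2" | j where "n = Suc (Suc (Suc j))"
    by (metis One_nat_def Suc_1 not0_implies_Suc)
  then show ?case
  proof cases
    case 3
    have "csym y1 y2 n * alt_sum (e_pow (1, 1)) =
      y1 * (y1 * alt_sum (e_pow (1, 1))) - y2 * alt_sum (e_pow (1, 1))"
      by (simp add: 3 numeral_2_eq_2 algebra_simps)
    also have "\<dots> = alt_sum (e_pow (3, 1))"
      by (simp add: y1_alt_sum y2_alt_sum alt_sum_wall)
    finally show ?thesis using 3 by simp
  next
    case (4 j)
    let ?J = "alt_sum (e_pow (1, 1))"
    have "csym y1 y2 n * ?J = y1 * (csym y1 y2 (Suc (Suc j)) * ?J)
        - y2 * (csym y1 y2 (Suc j) * ?J) + csym y1 y2 j * ?J"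
      by (simp add: 4 algebra_simps)
    also have "\<dots> = y1 * alt_sum (e_pow (3 + int j, 1)) - y2 * alt_sum (e_pow (2 + int j, 1))
        + alt_sum (e_pow (1 + int j, 1))"
      using less[of "Suc (Suc j)"] less[of "Suc j"] less[of j] 4 by (simp add: algebra_simps)
    also have "\<dots> = alt_sum (e_pow (4 + int j, 1))"
      by (simp add: y1_alt_sum y2_alt_sum alt_sum_wall algebra_simps)
    finally show ?thesis using 4 by (simp add: algebra_simps)
  qed (simp_all add: y1_alt_sum alt_sum_wall)
qed

lemma csym_alt_sum2:
  "csym y2 y1 n * alt_sum (e_pow (1, 1)) = alt_sum (e_pow (1, 1 + int n))"
proof (induction n rule: less_induct)
  case (less n)
  consider "n = 0" | "n = 1" | "n = 2" | j where "n = Suc (Suc (Suc j))"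
    by (metis One_nat_def Suc_1 not0_implies_Suc)
  then show ?case
  proof cases
    case 3
    have "csym y2 y1 n * alt_sum (e_pow (1, 1)) =
      y2 * (y2 * alt_sum (e_pow (1, 1))) - y1 * alt_sum (e_pow (1, 1))"
      by (simp add: 3 numeral_2_eq_2 algebra_simps)
    also have "\<dots> = alt_sum (e_pow (1, 3))"
      by (simp add: y1_alt_sum y2_alt_sum alt_sum_wall)
    finally show ?thesis using 3 by simp
  next
    case (4 j)
    let ?J = "alt_sum (e_pow (1, 1))"
    have "csym y2 y1 n * ?J = y2 * (csym y2 y1 (Suc (Suc j)) * ?J)
        - y1 * (csym y2 y1 (Suc j) * ?J) + csym y2 y1 j * ?J"
      by (simp add: 4 algebra_simps)
    also have "\<dots> = y2 * alt_sum (e_pow (1, 3 + int j)) - y1 * alt_sum (e_pow (1, 2 + int j))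
        + alt_sum (e_pow (1, 1 + int j))"
      using less[of "Suc (Suc j)"] less[of "Suc j"] less[of j] 4 by (simp add: algebra_simps)
    also have "\<dots> = alt_sum (e_pow (1, 4 + int j))"
      by (simp add: y1_alt_sum y2_alt_sum alt_sum_wall algebra_simps)
    finally show ?thesis using 4 by (simp add: algebra_simps)
  qed (simp_all add: y2_alt_sum alt_sum_wall)
qed

lemma weyl_char_multiples:
  "weyl_char (int n, 0) = csym y1 y2 n" "weyl_char (0, int n) = csym y2 y1 n"
  using csym_alt_sum1[of n] csym_alt_sum2[of n]
  by (auto intro!: weyl_char_eqI simp: weyl_rho_def)

definition var1 :: bipoly where "var1 = Poly_Mapping.single (1, 0) 1"
definition var2 :: bipoly where "var2 = Poly_Mapping.single (0, 1) 1"

lemma bipoly_eval_var: "bipoly_eval var1 x y = x" "bipoly_eval var2 x y = y"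
  by (simp_all add: var1_def var2_def bipoly_eval_single)

text \<open>
  Existence is the recursion for the characters, uniqueness their algebraic independence.
\<close>

lemma Q_A2_eq: "Q_A2 k = (csym var1 var2 k, csym var2 var1 k)"
proof -
  have y: "weyl_char (1, 0) = y1" "weyl_char (0, 1) = y2"
    using weyl_char_multiples[of 1] by simp_all
  have uniq: "P = P'" if "bipoly_eval P y1 y2 = bipoly_eval P' y1 y2" for P P'
    using bipoly_eval_y_eq_0[of "P - P'"] that by (simp add: bipoly_eval_diff)
  show ?thesis
    unfolding Q_A2_def y weyl_char_multiples
    by (rule the_equality)
       (auto simp: bipoly_eval_csym bipoly_eval_var prod_eq_iff intro!: uniq)
qed

section \<open>Dickson polynomials and the diagonal\<close>

definition peval :: "'a::comm_ring_1 \<Rightarrow> int poly \<Rightarrow> 'a" where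
  "peval x P = poly (map_poly of_int P) x"

lemma peval_pCons [simp]: "peval x (pCons c P) = of_int c + x * peval x P"
  by (simp add: peval_def map_poly_pCons)

lemma peval_0 [simp]: "peval x 0 = 0"
  by (simp add: peval_def)

lemma peval_1 [simp]: "peval x 1 = 1"
  by (simp add: peval_def)

lemma peval_add [simp]: "peval x (P + Q) = peval x P + peval x Q"
  by (induction P Q rule: poly_induct2) (simp_all add: algebra_simps)

lemma peval_diff [simp]: "peval x (P - Q) = peval x P - peval x Q"
  using peval_add[of x "P - Q" Q] by simp

lemma peval_smult [simp]: "peval x (Polynomial.smult c P) = of_int c * peval x P"
  by (induction P) (simp_all add: algebra_simps)

lemma peval_mult [simp]: "peval x (P * Q) = peval x P * peval x Q"
  by (induction P) (simp_all add: algebra_simps)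

lemma peval_power [simp]: "peval x (P ^ n) = peval x P ^ n"
  by (induction n) simp_all

lemma peval_sum: "peval x (\<Sum>i\<in>S. P i) = (\<Sum>i\<in>S. peval x (P i))"
  by (induction S rule: infinite_finite_induct) simp_all

lemma peval_of_nat [simp]: "peval x (of_nat c) = of_nat c"
  by (simp add: of_nat_poly)

lemma peval_numeral [simp]: "peval x (numeral c) = numeral c"
  using peval_of_nat[of x "numeral c"] by simp

lemma peval_pcompose [simp]: "peval x (pcompose P Q) = peval (peval x Q) P"
  by (induction P) (simp_all add: pcompose_pCons)

lemma peval_csym: "peval x (csym P Q n) = csym (peval x P) (peval x Q) n"
  by (induction P Q n rule: csym.induct) simp_all

text \<open>
  The identities below are verified at the infinitely many numbers \<open>a + 1/a\<close>, where each of the polynomials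
  involved becomes a quotient of short expressions in \<open>a\<^sup>n\<close>.
\<close>

lemma int_poly_eqI:
  assumes "\<And>a b :: real. a * b = 1 \<Longrightarrow> a \<noteq> b \<Longrightarrow> peval (a + b) P = peval (a + b) Q"
  shows "P = Q"
proof (rule ccontr)
  assume "P \<noteq> Q"
  have "inj_on (\<lambda>a :: real. a + 1 / a) {1<..}"
  proof (rule inj_onI)
    fix a b :: real
    assume "a \<in> {1<..}" "b \<in> {1<..}" and eq: "a + 1 / a = b + 1 / b"
    then have ab: "a > 1" "b > 1" by auto
    then have "(a - b) * (a * b - 1) = 0"
      using eq by (simp add: field_simps)
    moreover have "a * b > 1"
      using ab less_1_mult by blast
    ultimately show "a = b" by simp
  qed
  then have "infinite ((\<lambda>a :: real. a + 1 / a) ` {1<..})"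
    by (simp add: finite_image_iff infinite_Ioi)
  moreover have "map_poly real_of_int (P - Q) \<noteq> 0"
    using \<open>P \<noteq> Q\<close> by (simp add: map_poly_eq_0_iff)
  moreover have "(\<lambda>a :: real. a + 1 / a) ` {1<..} \<subseteq> {x. poly (map_poly real_of_int (P - Q)) x = 0}"
  proof safe
    fix a :: real
    assume "a > 1"
    then have "a * (1 / a) = 1" "a \<noteq> 1 / a"
      by (auto simp: field_simps) (metis less_1_mult less_irrefl)
    then show "poly (map_poly real_of_int (P - Q)) (a + 1 / a) = 0"
      using assms[of a "1 / a"] peval_diff[of "a + 1 / a" P Q] by (simp add: peval_def)
  qed
  ultimately show False
    using poly_roots_finite finite_subset by blast
qed

text \<open>
  The Dickson polynomials of the first kind with parameter \<open>1\<close>: \<open>D\<^sub>n(a + 1/a) = a\<^sup>n + a\<^sup>-\<^sup>n\<close>.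
\<close>

fun dickson :: "nat \<Rightarrow> int poly" where
  "dickson 0 = 2"
| "dickson (Suc 0) = [:0, 1:]"
| "dickson (Suc (Suc n)) = [:0, 1:] * dickson (Suc n) - dickson n"

text \<open>
  The Dickson polynomials of the second kind, with the index shifted by one so that
  \<open>U\<^sub>n(a + 1/a) = (a\<^sup>n - a\<^sup>-\<^sup>n) / (a - a\<^sup>-\<^sup>1)\<close>.
\<close>

fun dicksonU :: "nat \<Rightarrow> int poly" where
  "dicksonU 0 = 0"
| "dicksonU (Suc 0) = 1"
| "dicksonU (Suc (Suc n)) = [:0, 1:] * dicksonU (Suc n) - dicksonU n"

lemma peval_dickson:
  fixes a b :: "'a::comm_ring_1"
  assumes "a * b = 1"
  shows "peval (a + b) (dickson n) = a ^ n + b ^ n"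
proof (induction n rule: dickson.induct)
  case (3 n)
  have "(a + b) * (a * a ^ n + b * b ^ n) - (a ^ n + b ^ n)
      = a * a * a ^ n + b * b * b ^ n + (a * b - 1) * (a ^ n + b ^ n)"
    by (simp add: algebra_simps)
  with 3 assms show ?case by simp
qed simp_all

declare dickson.simps(3) [simp del]

lemma peval_dicksonU:
  fixes a b :: "'a::comm_ring_1"
  assumes "a * b = 1"
  shows "(a - b) * peval (a + b) (dicksonU n) = a ^ n - b ^ n"
proof (induction n rule: dicksonU.induct)
  case (3 n)
  have "(a - b) * peval (a + b) (dicksonU (Suc (Suc n)))
      = (a + b) * ((a - b) * peval (a + b) (dicksonU (Suc n))) - (a - b) * peval (a + b) (dicksonU n)"
    by (simp add: algebra_simps)
  also have "\<dots> = (a + b) * (a * a ^ n - b * b ^ n) - (a ^ n - b ^ n)"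
    using 3 by simp
  also have "\<dots> = a * a * a ^ n - b * b * b ^ n + (a * b - 1) * (a ^ n - b ^ n)"
    by (simp add: algebra_simps)
  finally show ?case using assms by simp
qed simp_all

lemma power_inverse_pair: "a * b = (1 :: 'a::comm_ring_1) \<Longrightarrow> a ^ n * b ^ n = 1"
  by (metis power_mult_distrib power_one)

lemma dickson_pcompose: "pcompose (dickson m) (dickson n) = dickson (m * n)"
proof (rule int_poly_eqI)
  fix a b :: real assume "a * b = 1"
  then show "peval (a + b) (pcompose (dickson m) (dickson n)) = peval (a + b) (dickson (m * n))"
    by (simp add: peval_dickson power_inverse_pair mult.commute[of m] power_mult)
qed

lemma square_diff_pair: "a * b = (1 :: 'a::comm_ring_1) \<Longrightarrow> (a + b)\<^sup>2 - 4 = (a - b) * (a - b)"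
  by (simp add: power2_eq_square algebra_simps)

text \<open>
  If \<open>a\<^sup>2\<^sup>n = 1\<close> then \<open>a\<^sup>m\<^sup>+\<^sup>2\<^sup>n = a\<^sup>m\<close>. This identity expresses the consequence for \<open>x = a + 1/a\<close> without
  mentioning \<open>a\<close>, which need not lie in the field of \<open>x\<close>.
\<close>

lemma dickson_shift: "dickson (m + 2 * n) - dickson m = ([:0, 1:]\<^sup>2 - 4) * dicksonU n * dicksonU (m + n)"
proof (rule int_poly_eqI)
  fix a b :: real assume ab: "a * b = 1"
  have "peval (a + b) (([:0, 1:]\<^sup>2 - 4) * dicksonU n * dicksonU (m + n))
      = ((a - b) * peval (a + b) (dicksonU n)) * ((a - b) * peval (a + b) (dicksonU (m + n)))"
    by (simp add: square_diff_pair[OF ab] mult_ac)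
  also have "\<dots> = (a ^ n - b ^ n) * (a ^ m * a ^ n - b ^ m * b ^ n)"
    by (simp only: peval_dicksonU[OF ab] power_add)
  also have "\<dots> = a ^ m * (a ^ n)\<^sup>2 + b ^ m * (b ^ n)\<^sup>2 - (a ^ m + b ^ m) * (a ^ n * b ^ n)"
    by (simp add: algebra_simps power2_eq_square)
  also have "\<dots> = a ^ m * (a ^ n)\<^sup>2 + b ^ m * (b ^ n)\<^sup>2 - (a ^ m + b ^ m)"
    by (simp add: power_inverse_pair[OF ab])
  also have "\<dots> = peval (a + b) (dickson (m + 2 * n) - dickson m)"
    by (simp add: peval_dickson[OF ab] power_add power_mult power2_eq_square power_mult_distrib)
  finally show "peval (a + b) (dickson (m + 2 * n) - dickson m) =
    peval (a + b) (([:0, 1:]\<^sup>2 - 4) * dicksonU n * dicksonU (m + n))" ..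
qed

lemma dickson_even: "dickson (2 * n) - 2 = ([:0, 1:]\<^sup>2 - 4) * (dicksonU n)\<^sup>2"
  using dickson_shift[of 0 n] by (simp add: power2_eq_square algebra_simps)

text \<open>
  In a field with \<open>n + 1\<close> elements \<open>D\<^sub>n\<^sub>+\<^sub>1\<close> is the identity map, so the right side vanishes. The identity
  therefore replaces the statement that \<open>x = a + 1/a\<close> lies in the field only if \<open>a\<^sup>n = 1\<close> or
  \<open>a\<^sup>n\<^sup>+\<^sup>2 = 1\<close>.
\<close>

lemma dickson_neighbours:
  "(dickson n - 2) * (dickson (n + 2) - 2) = (dickson (n + 1) - [:0, 1:])\<^sup>2"
proof (rule int_poly_eqI)
  fix a b :: real assume ab: "a * b = 1"
  have "(A + B - 2) * (a * (a * A) + b * (b * B) - 2) = (a * A + b * B - (a + b))\<^sup>2"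
    if "A * B = 1" for A B
  proof -
    have "(A + B - 2) * (a * (a * A) + b * (b * B) - 2) = a\<^sup>2 * A\<^sup>2 + b\<^sup>2 * B\<^sup>2
        + (a\<^sup>2 + b\<^sup>2) * (A * B) - 2 * A - 2 * B - 2 * a\<^sup>2 * A - 2 * b\<^sup>2 * B + 4"
      by (simp add: algebra_simps power2_eq_square)
    moreover have "(a * A + b * B - (a + b))\<^sup>2 = a\<^sup>2 * A\<^sup>2 + b\<^sup>2 * B\<^sup>2 + 2 * (a * b) * (A * B)
        - 2 * a\<^sup>2 * A - 2 * b\<^sup>2 * B - 2 * (a * b) * (A + B) + a\<^sup>2 + b\<^sup>2 + 2 * (a * b)"
      by (simp add: algebra_simps power2_eq_square)
    ultimately show ?thesis
      by (simp add: ab that)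
  qed
  from this[OF power_inverse_pair[OF ab, of n]]
  show "peval (a + b) ((dickson n - 2) * (dickson (n + 2) - 2))
      = peval (a + b) ((dickson (n + 1) - [:0, 1:])\<^sup>2)"
    by (simp add: peval_dickson[OF ab])
qed

text \<open>
  The common value of both components of \<open>Q\<close> at \<open>y\<^sub>1 = y\<^sub>2 = X + 1\<close>. With \<open>X = a + 1/a\<close> this is the value of
  the character at the diagonal matrix with entries \<open>1, a, 1/a\<close>, which explains the shift by one.
\<close>

definition diag :: "nat \<Rightarrow> int poly" where
  "diag k = csym [:1, 1:] [:1, 1:] k"

text \<open>
  On the diagonal the character is a product: the third-order recursion has the characteristic roots
  \<open>1, a, b\<close>, and the resulting combination of powers factors.
\<close>

lemma csym_diagonal:
  fixes a b :: "'a::comm_ring_1"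
  assumes ab: "a * b = 1"
  defines "y \<equiv> 1 + a + b"
  shows "(a - 1) * (a\<^sup>2 - 1) * a ^ k * csym y y k = (a ^ (k + 1) - 1) * (a ^ (k + 2) - 1)"
proof (induction k rule: less_induct)
  case (less k)
  have y: "a * y = a\<^sup>2 + a + 1"
    using ab by (simp add: y_def algebra_simps power2_eq_square)
  consider "k = 0" | "k = 1" | "k = 2" | j where "k = Suc (Suc (Suc j))"
    by (metis One_nat_def Suc_1 not0_implies_Suc)
  then show ?case
  proof cases
    case 1
    then show ?thesis by (simp add: power2_eq_square)
  next
    case 2
    have "(a - 1) * (a\<^sup>2 - 1) * (a * y) = (a ^ 2 - 1) * (a ^ 3 - 1)"
      unfolding y by (simp add: algebra_simps power2_eq_square power3_eq_cube)
    with 2 show ?thesis by (simp add: numeral_2_eq_2 numeral_3_eq_3 mult.assoc)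
  next
    case 3
    have "(a - 1) * (a\<^sup>2 - 1) * ((a * y) * (a * y) - a * (a * y)) = (a ^ 3 - 1) * (a ^ 4 - 1)"
      unfolding y by (simp add: algebra_simps power2_eq_square power3_eq_cube power4_eq_xxxx)
    with 3 show ?thesis
      by (simp add: numeral_2_eq_2 numeral_3_eq_3 numeral_eq_Suc algebra_simps)
  next
    case (4 j)
    let ?c = "(a - 1) * (a\<^sup>2 - 1)" and ?h = "csym y y"
    have "?c * a ^ k * ?h k = (a * y) * (?c * a ^ (j + 2) * ?h (j + 2))
        - a * (a * y) * (?c * a ^ (j + 1) * ?h (j + 1)) + a ^ 3 * (?c * a ^ j * ?h j)"
      by (simp add: 4 algebra_simps numeral_eq_Suc)
    also have "\<dots> = (a\<^sup>2 + a + 1) * ((a ^ (j + 3) - 1) * (a ^ (j + 4) - 1))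
        - a * (a\<^sup>2 + a + 1) * ((a ^ (j + 2) - 1) * (a ^ (j + 3) - 1))
        + a ^ 3 * ((a ^ (j + 1) - 1) * (a ^ (j + 2) - 1))"
      using less[of j] less[of "j + 1"] less[of "j + 2"] 4 y by (simp add: numeral_eq_Suc)
    also have "\<dots> = (a ^ (k + 1) - 1) * (a ^ (k + 2) - 1)"
      by (simp add: 4 algebra_simps numeral_eq_Suc)
    finally show ?thesis .
  qed
qed

text \<open>
  The factors \<open>a\<^sup>n - 1\<close> are not symmetric under \<open>a \<mapsto> 1/a\<close>, but
  \<open>(a\<^sup>n - 1)\<^sup>2 / a\<^sup>n = D\<^sub>n(a + 1/a) - 2\<close> is; so the factorization becomes one over the integers after squaring.
  The second factor on the left is \<open>(D\<^sub>1 - 2) (D\<^sub>2 - 2)\<close>.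
\<close>

lemma diag_square:
  "(diag k)\<^sup>2 * (([:0, 1:] - 2) * ([:0, 1:]\<^sup>2 - 4)) = (dickson (k + 1) - 2) * (dickson (k + 2) - 2)"
proof (rule int_poly_eqI)
  fix a b :: real assume ab: "a * b = 1"
  define h where "h = csym (1 + a + b) (1 + a + b) k"
  have h: "peval (a + b) (diag k) = h"
    by (simp add: diag_def peval_csym h_def add.assoc)
  have h_eq: "(a - 1) * (a\<^sup>2 - 1) * a ^ k * h = (a * a ^ k - 1) * (a * (a * a ^ k) - 1)"
    using csym_diagonal[OF ab, of k] by (simp add: h_def)
  have "h\<^sup>2 * ((a + b - 2) * ((a + b)\<^sup>2 - 4)) = (A * a + B * b - 2) * (a * (A * a) + b * (B * b) - 2)"
    if "A * B = 1" and h: "(a - 1) * (a\<^sup>2 - 1) * A * h = (a * A - 1) * (a * (a * A) - 1)" for A B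
  proof -
    have "(1 - b) = (a - 1) * b" "a - b = (a\<^sup>2 - 1) * b"
      using ab by (simp_all add: algebra_simps power2_eq_square)
    then have "h * ((1 - b) * (a - b)) = h * (((a - 1) * b) * ((a\<^sup>2 - 1) * b)) * (A * B)"
      using \<open>A * B = 1\<close> by simp
    also have "\<dots> = ((a - 1) * (a\<^sup>2 - 1) * A * h) * (B * b\<^sup>2)"
      by (simp add: mult_ac power2_eq_square)
    finally have *: "h * ((1 - b) * (a - b)) = (a * A - 1) * (a * (a * A) - 1) * (B * b\<^sup>2)"
      by (simp only: h)
    have "(1 - b)\<^sup>2 * a = a - 2 * (a * b) + (a * b) * b"
      by (simp add: algebra_simps power2_eq_square)
    then have "h\<^sup>2 * ((a + b - 2) * ((a + b)\<^sup>2 - 4)) = (h * ((1 - b) * (a - b)))\<^sup>2 * a"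
      unfolding square_diff_pair[OF ab] by (simp add: ab power2_eq_square mult_ac)
    also have "\<dots> = (A * a + B * b - 2) * (a * (A * a) + b * (B * b) - 2)"
    proof -
      have "(a * A - 1)\<^sup>2 * (B * b) = (a * A) * ((a * b) * (A * B)) - 2 * ((a * b) * (A * B)) + B * b"
        "(a * (a * A) - 1)\<^sup>2 * (B * b\<^sup>2) =
          a * (A * a) * ((a * b)\<^sup>2 * (A * B)) - 2 * ((a * b)\<^sup>2 * (A * B)) + b * (B * b)"
        by (simp_all add: algebra_simps power2_eq_square)
      then have "A * a + B * b - 2 = (a * A - 1)\<^sup>2 * (B * b)"
        "a * (A * a) + b * (B * b) - 2 = (a * (a * A) - 1)\<^sup>2 * (B * b\<^sup>2)"
        by (simp_all add: ab \<open>A * B = 1\<close> mult_ac)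
      moreover have "((a * A - 1) * (a * (a * A) - 1) * (B * b\<^sup>2))\<^sup>2 * a
          = ((a * A - 1)\<^sup>2 * (B * b)) * ((a * (a * A) - 1)\<^sup>2 * (B * b\<^sup>2)) * (a * b)"
        by (simp add: power2_eq_square mult_ac)
      ultimately show ?thesis
        unfolding * by (simp only: ab mult_1_right)
    qed
    finally show ?thesis .
  qed
  from this[OF power_inverse_pair[OF ab] h_eq]
  have "h\<^sup>2 * ((a + b - 2) * ((a + b)\<^sup>2 - 4))
    = (a * a ^ k + b * b ^ k - 2) * (a * (a * a ^ k) + b * (b * b ^ k) - 2)"
    by (simp add: mult.commute)
  then show "peval (a + b) ((diag k)\<^sup>2 * (([:0, 1:] - 2) * ([:0, 1:]\<^sup>2 - 4)))
      = peval (a + b) ((dickson (k + 1) - 2) * (dickson (k + 2) - 2))"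
    by (simp add: h peval_dickson[OF ab])
qed

text \<open>
  By the binomial theorem \<open>(a + 1/a)\<^sup>p\<close> is \<open>a\<^sup>p + a\<^sup>-\<^sup>p\<close> modulo \<open>p\<close>. Doubling both sides lets each term be
  combined with its mirror image, which turns every pair of powers into a Dickson polynomial.
\<close>

lemma dickson_frobenius:
  assumes p: "prime p"
  shows "\<exists>R. 2 * [:0, 1:] ^ p - 2 * dickson p = of_nat p * R"
proof -
  \<comment> \<open>The terms with index \<open>j\<close> and \<open>p - j\<close> have the exponents \<open>\<plusminus>(p - 2 j)\<close>.\<close>
  define d where "d j = dickson (nat \<bar>int p - 2 * int j\<bar>)" for j
  have d: "peval (a + b) (d j) = a ^ (p - j) * b ^ j + a ^ j * b ^ (p - j)"
    if ab: "a * b = 1" and "j \<le> p" for a b :: real and j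
  proof -
    have *: "a ^ (m + n) * b ^ n = a ^ m" "a ^ n * b ^ (m + n) = b ^ m" for m n
      using power_inverse_pair[OF ab, of n] by (simp_all add: power_add)
    show ?thesis
    proof (cases "2 * j \<le> p")
      case True
      define m where "m = p - 2 * j"
      have "p - j = m + j" "nat \<bar>int p - 2 * int j\<bar> = m"
        using True by (simp_all add: m_def)
      then show ?thesis by (simp add: d_def peval_dickson[OF ab] *)
    next
      case False
      define m n where "m = 2 * j - p" and "n = p - j"
      have "j = m + n" "p = m + n + n" "nat \<bar>int p - 2 * int j\<bar> = m"
        using False \<open>j \<le> p\<close> by (simp_all add: m_def n_def)
      then show ?thesis
        using *[where m = m and n = n] by (simp add: d_def peval_dickson[OF ab] mult.commute add.commute)
    qed
  qed
  have sum: "2 * [:0, 1:] ^ p = (\<Sum>j\<le>p. of_nat (p choose j) * d j)"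
  proof (rule int_poly_eqI)
    fix a b :: real assume ab: "a * b = 1"
    have "peval (a + b) (\<Sum>j\<le>p. of_nat (p choose j) * d j)
        = (\<Sum>j\<le>p. of_nat (p choose j) * b ^ j * a ^ (p - j)) +
          (\<Sum>j\<le>p. of_nat (p choose j) * a ^ j * b ^ (p - j))"
      by (simp add: peval_sum d[OF ab] distrib_left sum.distrib mult_ac)
    also have "\<dots> = 2 * (a + b) ^ p"
      by (simp add: binomial_ring[symmetric] add.commute)
    finally show "peval (a + b) (2 * [:0, 1:] ^ p) = peval (a + b) (\<Sum>j\<le>p. of_nat (p choose j) * d j)"
      by simp
  qed
  have p0: "p > 0" using p by (simp add: prime_gt_0_nat)
  have "(\<Sum>j\<le>p. of_nat (p choose j) * d j) = d 0 + d p + (\<Sum>j\<in>{1..<p}. of_nat (p choose j) * d j)"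
  proof -
    have "{..p} = insert 0 (insert p {1..<p})"
      using p0 by auto
    then show ?thesis using p0 by (simp add: add_ac)
  qed
  moreover have "d 0 + d p = 2 * dickson p"
    by (simp add: d_def nat_abs_int_diff)
  moreover have "of_nat p dvd (\<Sum>j\<in>{1..<p}. of_nat (p choose j) * d j)"
  proof (rule dvd_sum)
    fix j assume "j \<in> {1..<p}"
    then have "p dvd p choose j"
      using p p0 by (intro dvd_choose_prime) auto
    then have "(of_nat p :: int poly) dvd of_nat (p choose j)"
      by (metis of_nat_mult dvd_def)
    then show "of_nat p dvd of_nat (p choose j) * d j"
      by (rule dvd_mult2)
  qed
  ultimately show ?thesis
    unfolding sum by (auto elim!: dvdE)
qed

section \<open>Values at the special points and degrees\<close>

lemma poly_dickson_2: "poly (dickson n) 2 = 2"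
  by (induction n rule: dickson.induct) (simp_all add: dickson.simps(3))

lemma poly_dickson_minus2: "poly (dickson n) (- 2) = (if even n then 2 else - 2)"
  by (induction n rule: dickson.induct) (simp_all add: dickson.simps(3))

lemma poly_dickson_minus1: "poly (dickson n) (- 1) = (if 3 dvd n then 2 else - 1)"
proof (induction n rule: less_induct)
  case (less n)
  consider "n = 0" | "n = 1" | "n = 2" | j where "n = Suc (Suc (Suc j))"
    by (metis One_nat_def Suc_1 not0_implies_Suc)
  then show ?case
  proof cases
    case (4 j)
    have "(3 :: nat) dvd n \<longleftrightarrow> 3 dvd j"
      using 4 by presburger
    then show ?thesis
      using less[of j] 4 by (simp add: dickson.simps(3))
  qed (auto simp: numeral_2_eq_2 dickson.simps(3) dest: dvd_imp_le)
qed

lemma poly_dickson_0: "poly (dickson n) 0 = (if odd n then 0 else if 4 dvd n then 2 else - 2)"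
proof (induction n rule: dickson.induct)
  case (3 n)
  have "(4 :: nat) dvd Suc (Suc n) \<longleftrightarrow> even n \<and> \<not> 4 dvd n"
    by presburger
  then show ?case
    using 3 by (simp add: dickson.simps(3))
qed simp_all

lemma poly_diag: "poly (diag k) x = csym (x + 1) (x + 1) k"
proof -
  have "peval x P = poly P x" for P :: "int poly"
    by (induction P) simp_all
  from this[symmetric] show ?thesis
    by (simp add: diag_def peval_csym add.commute)
qed

text \<open>
  The factorization degenerates at \<open>a = 1\<close> and \<open>a = -1\<close>, that is at \<open>y = 3\<close> and \<open>y = -1\<close>. The values there
  come from the recursion; their product is \<open>3 \<tau>(k)\<close>.
\<close>

lemma csym_3: "2 * csym 3 3 k = (int k + 1) * (int k + 2)"
proof (induction k rule: less_induct)
  case (less n)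
  consider "n = 0" | "n = 1" | "n = 2" | j where "n = Suc (Suc (Suc j))"
    by (metis One_nat_def Suc_1 not0_implies_Suc)
  then show ?case
  proof cases
    case (4 j)
    then show ?thesis
      using less[of j] less[of "Suc j"] less[of "Suc (Suc j)"] by (simp add: algebra_simps)
  qed (simp_all add: numeral_2_eq_2)
qed

lemma csym_minus1: "4 * csym (- 1) (- 1) k = 1 + (- 1) ^ k * (2 * int k + 3)"
proof (induction k rule: less_induct)
  case (less n)
  consider "n = 0" | "n = 1" | "n = 2" | j where "n = Suc (Suc (Suc j))"
    by (metis One_nat_def Suc_1 not0_implies_Suc)
  then show ?case
  proof cases
    case (4 j)
    then show ?thesis
      using less[of j] less[of "Suc j"] less[of "Suc (Suc j)"] by (simp add: algebra_simps)
  qed (simp_all add: numeral_2_eq_2)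
qed

text \<open>
  The leading coefficient \<open>1\<close> survives reduction modulo every prime, so that the degree bounds the number
  of roots in fields of every characteristic.
\<close>

definition monic_of_degree :: "nat \<Rightarrow> int poly \<Rightarrow> bool" where
  "monic_of_degree n P \<longleftrightarrow> Polynomial.degree P \<le> n \<and> Polynomial.coeff P n = 1"

lemma monic_of_degree_mult:
  assumes "monic_of_degree m P" "monic_of_degree n Q"
  shows "monic_of_degree (m + n) (P * Q)"
proof -
  have "P \<noteq> 0" "Q \<noteq> 0" "Polynomial.degree P = m" "Polynomial.degree Q = n"
    using assms by (auto simp: monic_of_degree_def intro!: antisym intro: le_degree)
  then show ?thesis
    using assms coeff_degree_mult[of P Q] by (simp add: monic_of_degree_def degree_mult_eq)
qed

lemma monic_of_degree_diff:
  assumes "monic_of_degree n P" "Polynomial.degree Q < n"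
  shows "monic_of_degree n (P - Q)"
  using assms by (auto simp: monic_of_degree_def coeff_eq_0 intro!: degree_diff_le)

lemma monic_X: "monic_of_degree 1 [:0, 1:]"
  by (simp add: monic_of_degree_def)

lemma monic_dickson: "n > 0 \<Longrightarrow> monic_of_degree n (dickson n)"
proof (induction n rule: dickson.induct)
  case (3 n)
  have "Polynomial.degree (dickson n) < Suc (Suc n)"
    using 3 by (cases n) (auto simp: monic_of_degree_def)
  then show ?case
    using 3 monic_of_degree_mult[OF monic_X, of "Suc n" "dickson (Suc n)"] monic_of_degree_diff
    by (simp add: dickson.simps(3) del: mult_pCons_left)
qed (simp_all add: monic_of_degree_def)

lemma monic_dicksonU: "monic_of_degree n (dicksonU (Suc n))"
proof (induction n rule: induct_nat_012)
  case (ge2 n)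
  have "Polynomial.degree (dicksonU (Suc n)) < Suc (Suc n)"
    using ge2(1) by (auto simp: monic_of_degree_def)
  then show ?case
    using ge2 monic_of_degree_mult[OF monic_X, of "Suc n" "dicksonU (Suc (Suc n))"] monic_of_degree_diff
    by (simp del: mult_pCons_left)
qed (simp_all add: monic_of_degree_def)

section \<open>Integer polynomials over a finite field\<close>

text \<open>
  Horner evaluation. It is a ring homomorphism compatible with composition, and carries the identities
  between integer polynomials over to a field given by its carrier.
\<close>

definition int_eval :: "('a, 'b) ring_scheme \<Rightarrow> 'a \<Rightarrow> int poly \<Rightarrow> 'a" where
  "int_eval R x P =
    fold_coeffs (\<lambda>c v. add_pow R c \<one>\<^bsub>R\<^esub> \<oplus>\<^bsub>R\<^esub> x \<otimes>\<^bsub>R\<^esub> v) P \<zero>\<^bsub>R\<^esub>"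

context cring
begin

abbreviation cst :: "int \<Rightarrow> 'a" where
  "cst c \<equiv> add_pow R c \<one>"

abbreviation ev :: "'a \<Rightarrow> int poly \<Rightarrow> 'a" where
  "ev \<equiv> int_eval R"

lemma cst_closed: "cst c \<in> carrier R"
  by simp

lemma cst_0: "cst 0 = \<zero>"
  by (simp add: add_pow_def)

lemma cst_1: "cst 1 = \<one>"
  by (simp add: add.int_pow_1)

lemma cst_add: "cst (c + d) = cst c \<oplus> cst d"
  by (simp add: add.int_pow_mult)

lemma cst_mult: "cst (c * d) = cst c \<otimes> cst d"
  by (simp add: add_pow_ldistr_int add.int_pow_pow mult.commute)

lemma add_pow_eq_cst: "x \<in> carrier R \<Longrightarrow> add_pow R (c :: int) x = cst c \<otimes> x"
  by (simp add: add_pow_ldistr_int)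

lemma ev_0 [simp]: "ev x 0 = \<zero>"
  by (simp add: int_eval_def)

lemma ev_pCons: "x \<in> carrier R \<Longrightarrow> ev x (pCons c P) = cst c \<oplus> x \<otimes> ev x P"
  by (cases "c = 0 \<and> P = 0") (auto simp: int_eval_def cst_0)

lemma ev_closed [simp]: "x \<in> carrier R \<Longrightarrow> ev x P \<in> carrier R"
  by (induction P) (auto simp: ev_pCons)

lemma ev_const: "x \<in> carrier R \<Longrightarrow> ev x [:c:] = cst c"
  by (simp add: ev_pCons)

lemma ev_X: "x \<in> carrier R \<Longrightarrow> ev x [:0, 1:] = x"
  by (simp add: ev_pCons cst_0 cst_1)

lemma ev_1: "x \<in> carrier R \<Longrightarrow> ev x 1 = \<one>"
  by (simp add: one_pCons ev_const cst_1)

lemma ev_add_aux: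
  assumes "c \<in> carrier R" "d \<in> carrier R" "u \<in> carrier R" "v \<in> carrier R" "x \<in> carrier R"
  shows "(c \<oplus> d) \<oplus> x \<otimes> (u \<oplus> v) = (c \<oplus> x \<otimes> u) \<oplus> (d \<oplus> x \<otimes> v)"
  using assms by algebra

lemma ev_add: "x \<in> carrier R \<Longrightarrow> ev x (P + Q) = ev x P \<oplus> ev x Q"
proof (induction P Q rule: poly_induct2)
  case (pCons a P b Q)
  have "ev x (pCons a P + pCons b Q) = (cst a \<oplus> cst b) \<oplus> x \<otimes> (ev x P \<oplus> ev x Q)"
    using pCons by (simp only: add_pCons ev_pCons cst_add)
  also have "\<dots> = (cst a \<oplus> x \<otimes> ev x P) \<oplus> (cst b \<oplus> x \<otimes> ev x Q)"
    using pCons by (intro ev_add_aux) simp_all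
  finally show ?case
    using pCons by (simp only: ev_pCons)
qed simp

lemma ev_smult: "x \<in> carrier R \<Longrightarrow> ev x (Polynomial.smult c P) = cst c \<otimes> ev x P"
  by (induction P) (simp_all add: ev_pCons cst_mult r_distr m_ac)

lemma ev_mult: "x \<in> carrier R \<Longrightarrow> ev x (P * Q) = ev x P \<otimes> ev x Q"
  by (induction P) (simp_all add: ev_pCons ev_add ev_smult cst_0 l_distr m_assoc)

lemma ev_diff: "x \<in> carrier R \<Longrightarrow> ev x (P - Q) = ev x P \<ominus> ev x Q"
  using ev_add[of x "P - Q" Q] by (simp add: a_minus_def a_assoc r_neg)

lemma ev_power: "x \<in> carrier R \<Longrightarrow> ev x (P ^ n) = ev x P [^] n"
  by (induction n) (simp_all add: ev_1 ev_mult m_comm)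

lemma ev_sum: "finite S \<Longrightarrow> x \<in> carrier R \<Longrightarrow> ev x (\<Sum>i\<in>S. P i) = (\<Oplus>i\<in>S. ev x (P i))"
  by (induction S rule: finite_induct) (simp_all add: ev_add)

lemma ev_pcompose: "x \<in> carrier R \<Longrightarrow> ev x (pcompose P Q) = ev (ev x Q) P"
  by (induction P) (simp_all add: pcompose_pCons ev_pCons ev_add ev_mult ev_const)

text \<open>
  Values at images of integers are images of integer values, so that equations between them become
  divisibilities by the characteristic.
\<close>

lemma ev_at_cst: "ev (cst c) P = cst (poly P c)"
  by (induction P) (simp_all add: ev_pCons cst_0 cst_add cst_mult)

lemma ev_of_int: "x \<in> carrier R \<Longrightarrow> ev x (of_int c) = cst c"
  by (simp add: of_int_poly ev_const)

lemma ev_of_nat: "x \<in> carrier R \<Longrightarrow> ev x (of_nat c) = cst (int c)"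
  by (simp add: of_nat_poly ev_const)

lemma ev_numeral: "x \<in> carrier R \<Longrightarrow> ev x (numeral c) = cst (numeral c)"
  using ev_of_nat[of x "numeral c"] by simp

lemma ev_bipoly_eval:
  assumes x: "x \<in> carrier R"
  shows "bipoly_eval_ring R P (ev x A) (ev x B) = ev x (bipoly_eval P A B)"
proof -
  have "add_pow R c (ev x A [^] i \<otimes> ev x B [^] j) = ev x (of_int c * A ^ i * B ^ j)" for c i j
    using x by (simp only: add_pow_eq_cst ev_mult ev_power ev_of_int ev_closed m_closed
        nat_pow_closed cst_closed m_assoc)
  then show ?thesis
    unfolding bipoly_eval_def bipoly_eval_ring_def by (simp add: ev_sum x)
qed

end

lemma (in domain) card_roots_le:
  assumes fin: "finite (carrier R)" and P: "monic_of_degree n P"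
  shows "card {x \<in> carrier R. ev x P = \<zero>} \<le> n"
proof -
  interpret U: UP_domain R "UP R"
    by unfold_locales
  define f where "f i = cst (Polynomial.coeff P i)" for i
  have f: "f \<in> carrier (UP R)"
    using P by (auto simp: UP_def up_def bound_def f_def monic_of_degree_def coeff_eq_0 cst_0
        intro!: exI[of _ n])
  have coeff: "coeff (UP R) f i = f i" for i
    using f by (simp add: UP_def)
  have deg: "deg R f = n"
  proof (rule antisym)
    show "deg R f \<le> n"
      using f P by (intro U.deg_aboveI) (auto simp: coeff f_def monic_of_degree_def coeff_eq_0 cst_0)
    show "n \<le> deg R f"
      using f P by (intro U.deg_belowI) (auto simp: coeff f_def monic_of_degree_def cst_1)
  qed
  have nonzero: "f \<noteq> \<zero>\<^bsub>UP R\<^esub>"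
    using P coeff[of n] by (auto simp: f_def monic_of_degree_def cst_1)
  have eval: "eval R R id x f = ev x P" if x: "x \<in> carrier R" for x
  proof -
    have "P = (\<Sum>i\<le>n. Polynomial.smult (Polynomial.coeff P i) ([:0, 1:] ^ i))"
      using P poly_as_sum_of_monoms'[of P n] by (simp add: monic_of_degree_def monom_altdef)
    then have "ev x P = ev x (\<Sum>i\<le>n. Polynomial.smult (Polynomial.coeff P i) ([:0, 1:] ^ i))"
      by simp
    also have "\<dots> = (\<Oplus>i\<in>{..n}. f i \<otimes> x [^] i)"
      using x by (simp add: ev_sum ev_smult ev_power ev_X f_def)
    finally show ?thesis
      using x f by (simp add: U.eval_on_carrier deg coeff)
  qed
  then have "{x \<in> carrier R. ev x P = \<zero>} = {x \<in> carrier R. eval R R id x f = \<zero>}"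
    by auto
  then show ?thesis
    using U.roots_bound[OF f nonzero fin] deg by simp
qed

lemma (in domain) pow_eq_zeroD: "x \<in> carrier R \<Longrightarrow> x [^] (n :: nat) = \<zero> \<Longrightarrow> x = \<zero>"
  by (induction n) (auto simp: integral_iff)

locale odd_finite_field = field R for R (structure) +
  fixes p m :: nat
  assumes prime_p: "prime p" and odd_p: "odd p" and m_pos: "m \<ge> 1" and order_eq: "order R = p ^ m"
begin

definition q :: nat where "q = p ^ m"

lemma q_gt_2: "q > 2" and odd_q: "odd q"
proof -
  have "p > 2"
    using prime_p odd_p prime_ge_2_nat[of p] by (cases "p = 2") auto
  moreover have "p ^ 1 \<le> p ^ m"
    using m_pos \<open>p > 2\<close> by (intro power_increasing) auto
  ultimately show "q > 2" "odd q"
    using odd_p by (simp_all add: q_def)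
qed

lemma card_carrier: "card (carrier R) = q"
  using order_eq by (simp add: order_def q_def)

lemma finite_carrier: "finite (carrier R)"
  using card_carrier q_gt_2 by (metis card.infinite not_less_zero)

lemma cst_power: "cst (c ^ n) = cst c [^] n"
  by (induction n) (simp_all add: cst_1 cst_mult m_comm)

lemma cst_p: "cst (int p) = \<zero>"
proof -
  have "add_pow R (card (carrier R)) \<one> = \<zero>"
    using add.power_order_eq_one[of \<one>] finite_carrier by simp
  then have "cst (int p ^ m) = \<zero>"
    by (simp add: card_carrier q_def add_pow_int_ge flip: of_nat_power)
  then show ?thesis
    using pow_eq_zeroD[OF cst_closed, of "int p" m] by (simp add: cst_power)
qed

lemma cst_eq_0_iff: "cst c = \<zero> \<longleftrightarrow> int p dvd c"
proof
  assume c: "cst c = \<zero>"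
  show "int p dvd c"
  proof (rule ccontr)
    assume "\<not> int p dvd c"
    then have "coprime (int p) c"
      using prime_p by (simp add: prime_imp_coprime)
    then obtain u v where "u * int p + v * c = 1"
      by (metis bezout_int coprime_iff_gcd_eq_1)
    then have "cst u \<otimes> cst (int p) \<oplus> cst v \<otimes> cst c = \<one>"
      by (simp only: cst_1 flip: cst_add cst_mult)
    then show False
      by (simp add: cst_p c)
  qed
qed (auto simp: cst_mult cst_p elim!: dvdE)

lemma cst_eq_iff: "cst c = cst d \<longleftrightarrow> int p dvd c - d"
proof -
  have "cst c = cst (c - d) \<oplus> cst d"
    by (simp flip: cst_add)
  then have "cst c = cst d \<longleftrightarrow> cst (c - d) = \<zero>"
    by (simp add: add.l_cancel_one')
  then show ?thesis by (simp add: cst_eq_0_iff)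
qed

lemma frobenius_fixed:
  assumes x: "x \<in> carrier R"
  shows "x [^] q = x"
proof (cases "x = \<zero>")
  case True
  then show ?thesis using q_gt_2 by (simp add: nat_pow_zero)
next
  case False
  have "card (Units R) = q - 1"
    using finite_carrier card_carrier by (simp add: field_Units)
  moreover have "x \<in> Units R"
    using x False by (simp add: field_Units)
  ultimately have "x [^] (q - 1) = \<one>"
    using units_power_order_eq_one[of x] finite_carrier
    by (metis Units_closed finite_subset subsetI)
  then have "x [^] Suc (q - 1) = x"
    using x by simp
  then show ?thesis using q_gt_2 by simp
qed

lemma ev_dickson_p:
  assumes x: "x \<in> carrier R"
  shows "ev x (dickson p) = x [^] p"
proof -
  obtain P where P: "2 * [:0, 1:] ^ p - 2 * dickson p = of_nat p * P"
    using dickson_frobenius[OF prime_p] by blast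
  have "ev x (2 * ([:0, 1:] ^ p - dickson p)) = ev x (of_nat p * P)"
    unfolding P[symmetric] by (simp add: right_diff_distrib)
  then have "cst 2 \<otimes> (x [^] p \<ominus> ev x (dickson p)) = \<zero>"
    using x by (simp only: ev_mult ev_diff ev_power ev_X ev_numeral ev_of_nat cst_p l_null ev_closed)
  moreover have "cst 2 \<noteq> \<zero>"
    using odd_p prime_p prime_ge_2_nat[of p] by (auto simp: cst_eq_0_iff dest!: zdvd_imp_le)
  ultimately show ?thesis
    using x by (auto simp: integral_iff)
qed

lemma ev_dickson_q:
  assumes x: "x \<in> carrier R"
  shows "ev x (dickson q) = x"
proof -
  have "ev x (dickson (p ^ i)) = x [^] (p ^ i)" for i
  proof (induction i)
    case (Suc i)
    have "ev x (dickson (p ^ Suc i)) = ev (ev x (dickson (p ^ i))) (dickson p)"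
      using x by (simp add: dickson_pcompose flip: ev_pcompose)
    then show ?case
      using x by (simp add: Suc ev_dickson_p nat_pow_pow mult.commute)
  qed (use x in \<open>simp add: ev_X\<close>)
  then show ?thesis
    using frobenius_fixed[OF x] by (simp add: q_def)
qed

text \<open>
  The set of \<open>x = a + 1/a\<close> in the field for which \<open>a\<^sup>n = 1\<close>.
\<close>

definition torus :: "nat \<Rightarrow> 'a set" where
  "torus n = {x \<in> carrier R. ev x (dickson n) = cst 2}"

lemma finite_torus: "finite (torus n)"
  using finite_carrier by (simp add: torus_def)

lemma torus_eq: "torus n = {x \<in> carrier R. ev x (dickson n - 2) = \<zero>}"
  by (auto simp: torus_def ev_diff ev_numeral)

text \<open>
  If \<open>a + 1/a\<close> is fixed by the Frobenius map then \<open>a\<^sup>q\<close> is \<open>a\<close> or \<open>1/a\<close>.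
\<close>

lemma carrier_eq_tori: "carrier R = torus (q - 1) \<union> torus (q + 1)"
proof
  show "carrier R \<subseteq> torus (q - 1) \<union> torus (q + 1)"
  proof
    fix x assume x: "x \<in> carrier R"
    have "(dickson (q - 1) - 2) * (dickson (q + 1) - 2) = (dickson q - [:0, 1:])\<^sup>2"
      using dickson_neighbours[of "q - 1"] q_gt_2 by simp
    then have "ev x (dickson (q - 1) - 2) \<otimes> ev x (dickson (q + 1) - 2) = ev x ((dickson q - [:0, 1:])\<^sup>2)"
      using x by (simp flip: ev_mult)
    also have "\<dots> = \<zero>"
      using x by (simp add: power2_eq_square ev_mult ev_diff ev_dickson_q ev_X a_minus_def r_neg)
    finally show "x \<in> torus (q - 1) \<union> torus (q + 1)"
      using x by (auto simp: torus_eq integral_iff)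
  qed
qed (auto simp: torus_def)

lemma ev_dickson_shift:
  assumes x: "x \<in> torus c" and c: "even c"
  shows "ev x (dickson (n + j * c)) = ev x (dickson n)"
proof (induction j)
  case (Suc j)
  obtain e where e: "c = 2 * e" using c by blast
  have xc: "x \<in> carrier R" using x by (simp add: torus_def)
  have "ev x (([:0, 1:]\<^sup>2 - 4) * (dicksonU e)\<^sup>2) = \<zero>"
    using x by (simp add: torus_eq e flip: dickson_even)
  then have "ev x (([:0, 1:]\<^sup>2 - 4) * dicksonU e) = \<zero>"
    using xc by (auto simp: ev_mult ev_power integral_iff intro: pow_eq_zeroD)
  then have "ev x (([:0, 1:]\<^sup>2 - 4) * dicksonU e * dicksonU (n + j * c + e)) = \<zero>"
    using xc by (simp add: ev_mult)
  then have "ev x (dickson (n + j * c + 2 * e)) = ev x (dickson (n + j * c))"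
    unfolding dickson_shift[symmetric] using xc by (simp add: ev_diff)
  then show ?case
    using Suc by (simp add: e algebra_simps)
qed simp

text \<open>
  As functions on the field, the Dickson polynomials depend on their index modulo this number only.
\<close>

definition period :: nat where "period = lcm (q - 1) (q + 1)"

lemma period_pos: "period > 0"
  using q_gt_2 by (simp add: period_def lcm_pos_nat)

lemma even_period: "even period"
  using odd_q by (simp add: period_def)

lemma ev_dickson_cong:
  assumes x: "x \<in> carrier R" and "[n = n'] (mod period)"
  shows "ev x (dickson n) = ev x (dickson n')"
proof -
  have shift: "ev x (dickson (i + j * period)) = ev x (dickson i)" for i j
  proof -
    obtain c where c: "x \<in> torus c" "c = q - 1 \<or> c = q + 1"
      using x carrier_eq_tori by auto
    then have "c dvd period" "even c"
      using odd_q by (auto simp: period_def)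
    then obtain r where "period = r * c" by (metis dvdE mult.commute)
    then show ?thesis
      using ev_dickson_shift[OF c(1) \<open>even c\<close>, of i "j * r"] by (simp add: mult.assoc)
  qed
  then have "ev x (dickson i) = ev x (dickson (i mod period))" for i
    by (metis mod_div_mult_eq)
  then show ?thesis
    using assms(2) by (metis cong_def)
qed

lemma ev_dickson_dickson: "x \<in> carrier R \<Longrightarrow> ev (ev x (dickson i)) (dickson j) = ev x (dickson (j * i))"
  by (simp add: dickson_pcompose flip: ev_pcompose)

text \<open>
  If \<open>v\<close> inverts \<open>u\<close> modulo the period then \<open>D\<^sub>v\<close> inverts \<open>D\<^sub>u\<close>.
\<close>

lemma dickson_permutes:
  assumes "coprime u period"
  shows "bij_betw (\<lambda>x. ev x (dickson u)) (carrier R) (carrier R)"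
proof -
  obtain v where v: "[u * v = 1] (mod period)"
    using assms by (metis One_nat_def cong_solve_coprime_nat)
  have id: "ev (ev x (dickson u)) (dickson v) = x" "ev (ev x (dickson v)) (dickson u) = x"
    if x: "x \<in> carrier R" for x
    using x ev_dickson_cong[OF x v] by (simp_all add: ev_dickson_dickson ev_X mult.commute)
  show ?thesis
    by (rule bij_betw_byWitness[where f' = "\<lambda>x. ev x (dickson v)"]) (auto simp: id)
qed

text \<open>
  \<open>D\<^sub>2\<^sub>c - 2\<close> is the product of \<open>x\<^sup>2 - 4\<close> and a square, so it has about half as many roots as its
  degree allows.
\<close>

lemma card_torus_le: "c > 0 \<Longrightarrow> card (torus (2 * c)) \<le> c + 1"
proof -
  assume "c > 0"
  then obtain e where c: "c = Suc e" by (cases c) auto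
  have "monic_of_degree 2 ([:0, 1:]\<^sup>2 - 4)"
    by (simp add: monic_of_degree_def power2_eq_square numeral_poly numeral_2_eq_2)
  then have "monic_of_degree (2 + e) (([:0, 1:]\<^sup>2 - 4) * dicksonU c)"
    unfolding c by (intro monic_of_degree_mult monic_dicksonU)
  from card_roots_le[OF finite_carrier this]
  have "card {x \<in> carrier R. ev x (([:0, 1:]\<^sup>2 - 4) * dicksonU c) = \<zero>} \<le> c + 1"
    by (simp add: c)
  moreover have "torus (2 * c) \<subseteq> {x \<in> carrier R. ev x (([:0, 1:]\<^sup>2 - 4) * dicksonU c) = \<zero>}"
    by (auto simp: torus_eq dickson_even power2_eq_square[of "dicksonU c"] ev_mult integral_iff)
  ultimately show ?thesis
    using finite_carrier card_mono[of "{x \<in> carrier R. ev x (([:0, 1:]\<^sup>2 - 4) * dicksonU c) = \<zero>}" "torus (2 * c)"]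
    by fastforce
qed

text \<open>
  The two tori cover the field and share \<open>2\<close> and \<open>-2\<close>, so neither of them can be much smaller than its
  upper bound.
\<close>

lemma card_torus_gt:
  assumes "c = q - 1 \<or> c = q + 1"
  shows "c < 2 * card (torus c)"
proof -
  obtain t where t: "q = 2 * t + 1" using odd_q by (elim oddE)
  have t0: "t > 0" using q_gt_2 t by simp
  have le: "card (torus (q - 1)) \<le> t + 1" "card (torus (q + 1)) \<le> t + 2"
    using card_torus_le[of t] card_torus_le[of "t + 1"] t0 by (simp_all add: t)
  have "cst 2 \<noteq> cst (- 2)"
  proof
    assume "cst 2 = cst (- 2)"
    then have "int p dvd int (2 ^ 2)" by (simp add: cst_eq_iff)
    then have "p dvd 2 ^ 2" by (simp only: int_dvd_int_iff)
    then have "p dvd 2" using prime_p prime_dvd_power by blast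
    then show False
      using odd_p prime_p prime_ge_2_nat[of p] by (auto dest!: dvd_imp_le)
  qed
  moreover have "{cst 2, cst (- 2)} \<subseteq> torus (q - 1) \<inter> torus (q + 1)"
    using odd_q by (auto simp: torus_def ev_at_cst poly_dickson_2 poly_dickson_minus2 simp del: add_uminus_conv_diff)
  ultimately have "2 \<le> card (torus (q - 1) \<inter> torus (q + 1))"
    using card_mono[of "torus (q - 1) \<inter> torus (q + 1)" "{cst 2, cst (- 2)}"] finite_carrier
    by (simp add: torus_def)
  moreover have "card (torus (q - 1)) + card (torus (q + 1)) = q + card (torus (q - 1) \<inter> torus (q + 1))"
    using card_Un_Int[OF finite_torus finite_torus, of "q - 1" "q + 1"]
    by (simp only: carrier_eq_tori[symmetric] card_carrier)
  ultimately show ?thesis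
    using le assms t by auto
qed

text \<open>
  The map \<open>D\<^sub>c\<^sub>/\<^sub>d\<close> takes the torus of \<open>c\<close> to the torus of \<open>d\<close>, and its fibres have at most \<open>c / d\<close> elements;
  hence the latter has more than \<open>d / 2\<close> elements. This is used in place of the existence of elements of order
  \<open>d\<close> in a cyclic group of order \<open>c\<close>, part of which lies in the quadratic extension of the field.
\<close>

lemma torsion_bound:
  assumes c: "c = q - 1 \<or> c = q + 1" and d: "d dvd c"
    and Z: "finite Z" "torus d \<subseteq> cst ` Z"
  shows "d < 2 * card Z"
proof -
  obtain e where e: "c = e * d" using d by (metis dvdE mult.commute)
  have "e > 0" using c q_gt_2 e by (cases e) auto
  define fibre where "fibre z = {x \<in> carrier R. ev x (dickson e - of_int z) = \<zero>}" for z
  have "monic_of_degree e (dickson e - of_int z)" for z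
    using \<open>e > 0\<close> by (intro monic_of_degree_diff monic_dickson) (auto simp: of_int_poly)
  then have fibre: "card (fibre z) \<le> e" for z
    unfolding fibre_def by (intro card_roots_le finite_carrier)
  have "torus c \<subseteq> (\<Union>z\<in>Z. fibre z)"
  proof
    fix x assume "x \<in> torus c"
    then have x: "x \<in> carrier R" "ev x (dickson e) \<in> torus d"
      by (auto simp: torus_def e ev_dickson_dickson mult.commute)
    then obtain z where "z \<in> Z" "ev x (dickson e) = cst z"
      using Z by blast
    then show "x \<in> (\<Union>z\<in>Z. fibre z)"
      using x by (auto simp: fibre_def ev_diff ev_of_int)
  qed
  then have "card (torus c) \<le> card (\<Union>z\<in>Z. fibre z)"
    using Z finite_carrier by (intro card_mono) (auto simp: fibre_def)
  also have "\<dots> \<le> (\<Sum>z\<in>Z. card (fibre z))"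
    by (rule card_UN_le[OF Z(1)])
  also have "\<dots> \<le> card Z * e"
    using sum_bounded_above[of Z "\<lambda>z. card (fibre z)" e] fibre by simp
  finally have "card (torus c) \<le> card Z * e" .
  then have "e * d < 2 * (card Z * e)"
    using card_torus_gt[OF c] e by linarith
  then have "e * d < e * (2 * card Z)"
    by (simp add: mult_ac)
  then show ?thesis
    using \<open>e > 0\<close> by (simp only: nat_mult_less_cancel1)
qed

end

section \<open>Zeros of an injective diagonal map\<close>

text \<open>
  The quotient \<open>n div gcd n N\<close> may have factors in common with \<open>N\<close>, but it matters only modulo
  \<open>N div gcd n N\<close>, to which it is prime. Adding a suitable multiple of the latter yields a unit.
\<close>

lemma unit_multiple_of_gcd_mod:
  fixes n N :: nat
  assumes "N > 0"
  shows "\<exists>u. coprime u N \<and> [gcd n N * u = n] (mod N)"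
proof -
  define d where "d = gcd n N"
  have "d > 0" using assms by (simp add: d_def)
  obtain n' N' where n: "n = n' * d" and N: "N = N' * d" and co: "coprime n' N'"
    using gcd_coprime_exists[of n N] \<open>d > 0\<close> unfolding d_def by auto
  \<comment> \<open>A prime factor of \<open>N\<close> divides exactly one of the two summands of \<open>u\<close>.\<close>
  define A where "A = {r \<in> prime_factors N. \<not> r dvd n'}"
  define u where "u = n' + \<Prod>A * N'"
  have "coprime u N"
  proof (rule ccontr)
    assume "\<not> coprime u N"
    then obtain r where r: "prime r" "r dvd u" "r dvd N"
      by (metis coprime_iff_gcd_eq_1 gcd_nat.boundedE prime_factor_nat)
    have rN: "r \<in> prime_factors N"
      using r assms by (simp add: in_prime_factors_iff)
    show False
    proof (cases "r dvd n'")
      case True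
      then have "r dvd \<Prod>A * N'"
        using r(2) by (simp add: u_def dvd_add_right_iff)
      moreover have "\<not> r dvd N'"
        using co True r(1) by (metis coprime_common_divisor_nat not_prime_1)
      ultimately have "r dvd \<Prod>A"
        using r(1) by (simp add: prime_dvd_mult_iff)
      then obtain r' where "r' \<in> A" "r dvd r'"
        using r(1) by (auto simp: prime_dvd_prod_iff A_def)
      then have "r = r'"
        using r(1) primes_dvd_imp_eq[of r r'] by (auto simp: A_def)
      then show False
        using \<open>r' \<in> A\<close> True by (simp add: A_def)
    next
      case False
      then have "r dvd \<Prod>A"
        using rN by (intro dvd_prodI[where f = "\<lambda>x. x", simplified]) (auto simp: A_def)
      then have "r dvd n'"
        using r(2) by (simp add: u_def dvd_add_left_iff)
      with False show False by simp
    qed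
  qed
  moreover have "[d * u = n] (mod N)"
  proof -
    have "d * u = n + N * \<Prod>A"
      by (simp add: u_def n N algebra_simps)
    then show ?thesis by (simp add: cong_def)
  qed
  ultimately show ?thesis
    unfolding d_def by blast
qed

context odd_finite_field
begin

text \<open>
  Only the residue of the index modulo the period matters, so the cofactor of the greatest common divisor can be
  taken prime to the period; by \<open>dickson_permutes\<close>, \<open>D\<^sub>u\<close> is then a permutation of the field.
\<close>

lemma ev_dickson_gcd:
  "\<exists>u. coprime u period \<and> (\<forall>x\<in>carrier R. ev x (dickson n) = ev (ev x (dickson u)) (dickson (gcd n period)))"
proof -
  obtain u where u: "coprime u period" "[gcd n period * u = n] (mod period)"
    using unit_multiple_of_gcd_mod[OF period_pos] by blast
  have "ev x (dickson n) = ev (ev x (dickson u)) (dickson (gcd n period))" if "x \<in> carrier R" for x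
    using that ev_dickson_cong[OF that u(2)] by (simp add: ev_dickson_dickson)
  then show ?thesis
    using u by blast
qed

lemma ev_linear_eq_0_iff: "x \<in> carrier R \<Longrightarrow> ev x [:- c, 1:] = \<zero> \<longleftrightarrow> x = cst c"
proof -
  assume x: "x \<in> carrier R"
  have "[:- c, 1:] = [:0, 1:] - [:c:]"
    by simp
  then show ?thesis
    using x by (simp only: ev_diff ev_X ev_const) simp
qed

lemma torus_dvd: "d dvd n \<Longrightarrow> torus d \<subseteq> torus n"
proof
  fix x assume "d dvd n" and x: "x \<in> torus d"
  then obtain e where e: "n = e * d" by (metis dvdE mult.commute)
  have "ev x (dickson n) = ev (ev x (dickson d)) (dickson e)"
    using x by (simp add: torus_def e flip: ev_dickson_dickson)
  then show "x \<in> torus n"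
    using x by (simp add: torus_def ev_at_cst poly_dickson_2)
qed

lemma X_minus_2: "[:0, 1:] - 2 = [:- 2, 1 :: int:]"
  by (simp add: numeral_poly)

lemma X_square_minus_4: "[:0, 1:]\<^sup>2 - 4 = [:- 2, 1:] * [:2, 1 :: int:]"
  by (simp add: numeral_poly power2_eq_square)

lemma diag_eq_0_iff:
  assumes x: "x \<in> carrier R" "x \<noteq> cst 2" "x \<noteq> cst (- 2)"
  shows "ev x (diag k) = \<zero> \<longleftrightarrow> x \<in> torus (k + 1) \<union> torus (k + 2)"
proof -
  have "ev x (diag k) \<otimes> ev x (diag k) \<otimes> (ev x [:- 2, 1:] \<otimes> (ev x [:- 2, 1:] \<otimes> ev x [:2, 1:]))
      = ev x (dickson (k + 1) - 2) \<otimes> ev x (dickson (k + 2) - 2)"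
    using diag_square[of k] x unfolding X_minus_2 X_square_minus_4
    by (simp add: power2_eq_square flip: ev_mult del: mult_pCons_left mult_pCons_right)
  moreover have "ev x [:- 2, 1:] \<noteq> \<zero>" "ev x [:2, 1:] \<noteq> \<zero>"
    using x ev_linear_eq_0_iff[of x 2] ev_linear_eq_0_iff[of x "- 2"] by simp_all
  ultimately have "ev x (diag k) = \<zero> \<longleftrightarrow>
      ev x (dickson (k + 1) - 2) \<otimes> ev x (dickson (k + 2) - 2) = \<zero>"
    using x(1) by (metis ev_closed integral_iff l_null m_closed)
  then show ?thesis
    using x(1) by (auto simp: torus_eq integral_iff)
qed

lemma prod_translate:
  assumes bij: "bij_betw g (carrier R) (carrier R)" and z: "z \<in> carrier R" "g z = \<zero>"
  shows "(\<Otimes>x\<in>carrier R - {z}. g x) = (\<Otimes>v\<in>carrier R - {\<zero>}. v)"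
proof -
  have "g ` (carrier R - {z}) = carrier R - {\<zero>}"
    using bij z by (auto simp: bij_betw_def inj_on_def image_iff)
  moreover have "inj_on g (carrier R - {z})"
    using bij by (auto simp: bij_betw_def inj_on_def)
  ultimately show ?thesis
    using finprod_reindex[of "\<lambda>v. v" g "carrier R - {z}"] by auto
qed

lemma dickson_2: "dickson 2 = [:- 2, 0, 1:]"
proof -
  have "dickson 2 = dickson (Suc (Suc 0))" by (simp only: numeral_2_eq_2)
  then show ?thesis by (simp add: dickson.simps(3) numeral_poly)
qed

text \<open>
  A zero \<open>x\<close> other than \<open>2\<close> and \<open>-2\<close> satisfies \<open>D\<^sub>n(x) = 2\<close> for \<open>n = k + 1\<close> or \<open>n = k + 2\<close>, and this property passes
  to \<open>D\<^sub>2(x)\<close> because \<open>D\<^sub>n\<close> and \<open>D\<^sub>2\<close> commute. Thus \<open>D\<^sub>2(x) = x\<^sup>2 - 2\<close> is the same zero or one of \<open>2\<close>, \<open>-2\<close>.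
  In terms of \<open>a\<close>, the cases that remain are primitive third and fourth roots of unity.
\<close>

lemma unique_zero:
  assumes inj: "inj_on (\<lambda>x. ev x (diag k)) (carrier R)"
    and nz: "ev (cst 2) (diag k) \<noteq> \<zero>" "ev (cst (- 2)) (diag k) \<noteq> \<zero>"
  shows "\<exists>x0\<in>{- 1, 0}. ev (cst x0) (diag k) = \<zero>"
proof -
  have "(\<lambda>x. ev x (diag k)) ` carrier R = carrier R"
    using inj finite_carrier by (intro endo_inj_surj) auto
  then obtain x where x: "x \<in> carrier R" "ev x (diag k) = \<zero>"
    by (metis imageE zero_closed)
  then have x2: "x \<noteq> cst 2" "x \<noteq> cst (- 2)"
    using nz by auto
  define y where "y = ev x (dickson 2)"
  have y: "y \<in> carrier R" using x by (simp add: y_def)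
  obtain n where n: "n = k + 1 \<or> n = k + 2" "x \<in> torus n"
    using x x2 diag_eq_0_iff[of x k] by auto
  have "ev y (dickson n) = ev (ev x (dickson n)) (dickson 2)"
    using x by (simp add: y_def ev_dickson_dickson mult.commute)
  then have "y \<in> torus n"
    using n(2) y by (simp add: torus_def ev_at_cst poly_dickson_2)
  then have "y = cst 2 \<or> y = cst (- 2) \<or> ev y (diag k) = \<zero>"
    using n(1) diag_eq_0_iff[OF y, of k] by auto
  then have "y = cst 2 \<or> y = cst (- 2) \<or> y = x"
    using x inj_onD[OF inj, of y x] y by auto
  then consider "y = cst 2" | "y = cst (- 2)" | "y = x" by blast
  then show ?thesis
  proof cases
    case 1
    have "ev x ([:- 2, 1:] * [:2, 1:]) = ev x (dickson 2 - [:2:])"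
      by (simp add: dickson_2)
    then have "ev x [:- 2, 1:] \<otimes> ev x [:2, 1:] = ev x (dickson 2 - [:2:])"
      using x(1) by (simp only: ev_mult)
    then have "ev x [:- 2, 1:] \<otimes> ev x [:2, 1:] = \<zero>"
      using x(1) 1 by (simp add: y_def ev_diff ev_const)
    then show ?thesis
      using x(1) x2 ev_linear_eq_0_iff[of x 2] ev_linear_eq_0_iff[of x "- 2"]
      by (auto simp: integral_iff)
  next
    case 2
    have "ev x ([:0, 1:] * [:0, 1:]) = ev x (dickson 2 - [:- 2:])"
      by (simp add: dickson_2)
    then have "ev x [:0, 1:] \<otimes> ev x [:0, 1:] = ev x (dickson 2 - [:- 2:])"
      using x(1) by (simp only: ev_mult)
    then have "ev x [:0, 1:] \<otimes> ev x [:0, 1:] = \<zero>"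
      using x(1) 2 by (simp add: y_def ev_diff ev_const)
    then have "x = cst 0"
      using x(1) by (simp add: integral_iff ev_X cst_0)
    then show ?thesis using x by auto
  next
    case 3
    have "ev x ([:- 2, 1:] * [:1, 1:]) = ev x (dickson 2 - [:0, 1:])"
      by (simp add: dickson_2)
    then have "ev x [:- 2, 1:] \<otimes> ev x [:1, 1:] = ev x (dickson 2 - [:0, 1:])"
      using x(1) by (simp only: ev_mult)
    then have "ev x [:- 2, 1:] \<otimes> ev x [:1, 1:] = \<zero>"
      using x(1) 3 by (simp add: y_def ev_diff ev_X a_minus_def r_neg)
    then have "x = cst (- 1)"
      using x(1) x2 ev_linear_eq_0_iff[of x 2] ev_linear_eq_0_iff[of x "- 1"]
      by (auto simp: integral_iff)
    then show ?thesis using x by auto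
  qed
qed

text \<open>
  Every element of the torus of \<open>gcd n c\<close> is in the torus of \<open>n\<close>, hence a zero or one of \<open>2\<close>, \<open>-2\<close>. As there is
  only one zero, the torus is so small that \<open>torsion_bound\<close> restricts \<open>gcd n c\<close>.
\<close>

lemma torsion_of_unique_zero:
  assumes inj: "inj_on (\<lambda>x. ev x (diag k)) (carrier R)"
    and x0: "ev (cst x0) (diag k) = \<zero>"
    and n: "n = k + 1 \<or> n = k + 2" and c: "c = q - 1 \<or> c = q + 1"
  shows "gcd n c < 2 * card {z \<in> {2, - 2, x0}. int p dvd poly (dickson (gcd n c)) z - 2}"
proof (rule torsion_bound[OF c])
  let ?d = "gcd n c"
  show "torus ?d \<subseteq> cst ` {z \<in> {2, - 2, x0}. int p dvd poly (dickson ?d) z - 2}"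
  proof
    fix x assume x: "x \<in> torus ?d"
    then have xc: "x \<in> carrier R" by (simp add: torus_def)
    have "x \<in> torus n" using x torus_dvd[of ?d n] by auto
    then have "x = cst 2 \<or> x = cst (- 2) \<or> ev x (diag k) = \<zero>"
      using diag_eq_0_iff[OF xc, of k] n by auto
    then have "x = cst 2 \<or> x = cst (- 2) \<or> x = cst x0"
      using x0 inj_onD[OF inj, of x "cst x0"] xc by auto
    then obtain z where z: "z = 2 \<or> z = - 2 \<or> z = x0" "x = cst z" by metis
    then have "cst (poly (dickson ?d) z) = cst 2"
      using x by (simp add: torus_def ev_at_cst)
    then have "z \<in> {z \<in> {2, - 2, x0}. int p dvd poly (dickson ?d) z - 2}"
      using z(1) unfolding cst_eq_iff by simp
    with z(2) show "x \<in> cst ` {z \<in> {2, - 2, x0}. int p dvd poly (dickson ?d) z - 2}"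
      by (rule image_eqI)
  qed
qed simp_all

section \<open>The product of the values of the diagonal map\<close>

text \<open>
  The index enters through its greatest common divisor with the period alone, because the remaining factor
  \<open>D\<^sub>u\<close> permutes the set over which the product is taken.
\<close>

lemma prod_dickson_gcd:
  assumes fixed: "\<And>u. coprime u period \<Longrightarrow> poly (dickson u) x0 = x0"
  defines "S \<equiv> carrier R - {cst 2, cst (- 2), cst x0}"
  shows "(\<Otimes>x\<in>S. ev x (dickson n - 2)) = (\<Otimes>x\<in>S. ev x (dickson (gcd n period) - 2))"
proof -
  obtain u where u: "coprime u period"
    "\<And>x. x \<in> carrier R \<Longrightarrow> ev x (dickson n) = ev (ev x (dickson u)) (dickson (gcd n period))"
    using ev_dickson_gcd[of n] by blast
  have "odd u"
    using coprime_common_divisor_nat[OF u(1), of 2] even_period by auto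
  define g where "g x = ev x (dickson u)" for x
  have bij: "bij_betw g (carrier R) (carrier R)"
    unfolding g_def by (rule dickson_permutes[OF u(1)])
  have injC: "inj_on g (carrier R)" and surj: "g ` carrier R = carrier R"
    using bij by (simp_all add: bij_betw_def)
  let ?T = "{cst 2, cst (- 2), cst x0}"
  have "g (cst 2) = cst 2" "g (cst (- 2)) = cst (- 2)" "g (cst x0) = cst x0"
    using \<open>odd u\<close> fixed[OF u(1)] by (simp_all add: g_def ev_at_cst poly_dickson_2 poly_dickson_minus2)
  then have T: "g ` ?T = ?T"
    by (simp only: image_insert image_empty)
  have "?T \<subseteq> carrier R"
    by simp
  from inj_on_image_set_diff[OF injC Diff_subset this] have gS: "g ` S = S"
    by (simp only: S_def surj T)
  have gc: "g x \<in> carrier R" if "x \<in> carrier R" for x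
    using that by (simp add: g_def)
  have inj: "inj_on g S"
    using injC Diff_subset unfolding S_def by (rule inj_on_subset)
  have "(\<Otimes>x\<in>S. ev x (dickson n - 2)) = (\<Otimes>x\<in>S. ev (g x) (dickson (gcd n period) - 2))"
  proof (rule finprod_cong'[OF refl])
    show "ev x (dickson n - 2) = ev (g x) (dickson (gcd n period) - 2)" if "x \<in> S" for x
    proof -
      have x: "x \<in> carrier R" using that by (simp add: S_def)
      show ?thesis
        by (simp only: ev_diff ev_numeral x gc u(2)[OF x] g_def[of x, symmetric])
    qed
  qed (simp add: S_def gc)
  also have "\<dots> = (\<Otimes>x\<in>g ` S. ev x (dickson (gcd n period) - 2))"
  proof (rule finprod_reindex[symmetric])
    show "(\<lambda>x. ev x (dickson (gcd n period) - 2)) \<in> g ` S \<rightarrow> carrier R"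
      unfolding gS by (simp add: S_def)
  qed (rule inj)
  finally show ?thesis
    by (simp only: gS)
qed

lemma prod_ev_mult:
  assumes "S \<subseteq> carrier R"
  shows "(\<Otimes>x\<in>S. ev x (P * Q)) = (\<Otimes>x\<in>S. ev x P) \<otimes> (\<Otimes>x\<in>S. ev x Q)"
proof -
  have "(\<Otimes>x\<in>S. ev x (P * Q)) = (\<Otimes>x\<in>S. ev x P \<otimes> ev x Q)"
  proof (rule finprod_cong'[OF refl])
    show "(\<lambda>x. ev x P \<otimes> ev x Q) \<in> S \<rightarrow> carrier R"
      using assms by (simp add: Pi_def subset_iff)
    show "ev x (P * Q) = ev x P \<otimes> ev x Q" if "x \<in> S" for x
      using that assms by (intro ev_mult) blast
  qed
  also have "\<dots> = (\<Otimes>x\<in>S. ev x P) \<otimes> (\<Otimes>x\<in>S. ev x Q)"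
    using assms by (intro finprod_multf) (simp_all add: Pi_def subset_iff)
  finally show ?thesis .
qed

lemma prod_nonzero:
  assumes "finite S" "S \<subseteq> carrier R" "\<And>x. x \<in> S \<Longrightarrow> ev x P \<noteq> \<zero>"
  shows "(\<Otimes>x\<in>S. ev x P) \<noteq> \<zero>"
  using assms
proof (induction S)
  case (insert x S)
  then have "(\<Otimes>x\<in>insert x S. ev x P) = ev x P \<otimes> (\<Otimes>x\<in>S. ev x P)"
    by (intro finprod_insert) (simp_all add: Pi_def subset_iff)
  moreover have "(\<Otimes>x\<in>S. ev x P) \<in> carrier R"
    using insert by (intro finprod_closed) (simp add: Pi_def subset_iff)
  ultimately show ?case
    using insert by (simp add: integral_iff)
qed simp

lemma mult_interchange:
  assumes "u \<in> carrier R" "v \<in> carrier R"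
  shows "(u \<otimes> v) \<otimes> (u \<otimes> v) = (u \<otimes> u) \<otimes> (v \<otimes> v)"
  using assms by algebra

lemma inj_self_bij:
  assumes "inj_on f (carrier R)" "\<And>x. x \<in> carrier R \<Longrightarrow> f x \<in> carrier R"
  shows "bij_betw f (carrier R) (carrier R)"
  using endo_inj_surj[OF finite_carrier _ assms(1)] assms by (simp add: bij_betw_def image_subset_iff)

lemma prod_split_two:
  assumes "a \<in> carrier R" "b \<in> carrier R" "a \<noteq> b" "c \<noteq> a" "c \<noteq> b" "f \<in> carrier R \<rightarrow> carrier R"
  shows "(\<Otimes>x\<in>carrier R - {c}. f x) = f a \<otimes> (f b \<otimes> (\<Otimes>x\<in>carrier R - {a, b, c}. f x))"
proof -
  let ?S = "carrier R - {a, b, c}"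
  have eq: "carrier R - {c} = insert a (insert b ?S)"
    using assms(1-5) by blast
  have f: "f \<in> ?S \<rightarrow> carrier R" "f \<in> insert b ?S \<rightarrow> carrier R" "f a \<in> carrier R" "f b \<in> carrier R"
    using assms(1,2,6) by (simp_all add: Pi_def)
  have fin: "finite ?S" using finite_carrier by simp
  have "(\<Otimes>x\<in>insert a (insert b ?S). f x) = f a \<otimes> (\<Otimes>x\<in>insert b ?S. f x)"
    using fin f \<open>a \<noteq> b\<close> by (intro finprod_insert) simp_all
  also have "(\<Otimes>x\<in>insert b ?S. f x) = f b \<otimes> (\<Otimes>x\<in>?S. f x)"
    using fin f by (intro finprod_insert) simp_all
  finally show ?thesis
    by (simp only: eq)
qed

text \<open>
  Both \<open>g(x)\<close>, the value of the diagonal map, and \<open>x - x0\<close> run through all nonzero elements once as \<open>x\<close> runs through the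
  elements other than \<open>x0\<close>, so their products agree. Over the elements other than \<open>2\<close>, \<open>-2\<close>, \<open>x0\<close>, the squares of the two
  products agree as well, by \<open>diag_square\<close> and the hypothesis on the greatest common divisors. What is left is
  \<open>(g(2) g(-2))\<^sup>2 = ((2 - x0) (- 2 - x0))\<^sup>2\<close>.
\<close>

lemma values_at_special_points:
  assumes inj: "inj_on (\<lambda>x. ev x (diag k)) (carrier R)"
    and x0: "ev (cst x0) (diag k) = \<zero>"
    and distinct: "cst 2 \<noteq> cst (- 2)" "cst x0 \<noteq> cst 2" "cst x0 \<noteq> cst (- 2)"
    and fixed: "\<And>u. coprime u period \<Longrightarrow> poly (dickson u) x0 = x0"
    and factors: "(dickson (gcd (k + 1) period) - 2) * (dickson (gcd (k + 2) period) - 2) =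
      [:- x0, 1:]\<^sup>2 * (([:0, 1:] - 2) * ([:0, 1:]\<^sup>2 - 4))"
  shows "int p dvd (poly (diag k) 2 * poly (diag k) (- 2))\<^sup>2 - (4 - x0\<^sup>2)\<^sup>2"
proof -
  define S where "S = carrier R - {cst 2, cst (- 2), cst x0}"
  define Pr where "Pr P = (\<Otimes>x\<in>S. ev x P)" for P
  have S: "S \<subseteq> carrier R" "finite S"
    unfolding S_def using finite_carrier by simp_all
  have S_not: "x \<noteq> cst 2" "x \<noteq> cst (- 2)" "x \<noteq> cst x0" if "x \<in> S" for x
    using that unfolding S_def by simp_all
  have Pr_closed: "Pr P \<in> carrier R" for P
    unfolding Pr_def using S(1) by (intro finprod_closed) auto
  have Pr_mult: "Pr (P * Q) = Pr P \<otimes> Pr Q" for P Q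
    unfolding Pr_def by (rule prod_ev_mult[OF S(1)])
  let ?l = "[:- x0, 1:]" and ?w = "([:0, 1:] - 2) * ([:0, 1:]\<^sup>2 - 4) :: int poly"
  have l0: "Pr ?l \<noteq> \<zero>"
    unfolding Pr_def
    by (rule prod_nonzero[OF S(2,1)]) (use S(1) S_not(3) ev_linear_eq_0_iff in blast)
  have w0: "Pr ?w \<noteq> \<zero>"
    unfolding Pr_def X_minus_2 X_square_minus_4
  proof (rule prod_nonzero[OF S(2,1)])
    fix x assume x: "x \<in> S"
    then have xc: "x \<in> carrier R" using S(1) by blast
    have "ev x [:- 2, 1:] \<noteq> \<zero>" "ev x [:2, 1:] \<noteq> \<zero>"
      using S_not[OF x] ev_linear_eq_0_iff[OF xc, of 2] ev_linear_eq_0_iff[OF xc, of "- 2"] by simp_all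
    then show "ev x ([:- 2, 1:] * ([:- 2, 1:] * [:2, 1:])) \<noteq> \<zero>"
      by (simp only: ev_mult[OF xc] integral_iff ev_closed[OF xc] m_closed simp_thms)
  qed
  have Pr_gcd: "Pr (dickson n - 2) = Pr (dickson (gcd n period) - 2)" for n
    unfolding Pr_def S_def by (rule prod_dickson_gcd, rule fixed)
  have "Pr ((diag k)\<^sup>2) \<otimes> Pr ?w = Pr (dickson (k + 1) - 2) \<otimes> Pr (dickson (k + 2) - 2)"
    unfolding Pr_mult[symmetric] by (rule arg_cong[OF diag_square])
  also have "\<dots> = Pr (dickson (gcd (k + 1) period) - 2) \<otimes> Pr (dickson (gcd (k + 2) period) - 2)"
    unfolding Pr_gcd[of "k + 1"] Pr_gcd[of "k + 2"] ..
  also have "\<dots> = Pr (?l\<^sup>2) \<otimes> Pr ?w"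
    unfolding Pr_mult[symmetric] by (rule arg_cong[OF factors])
  finally have sq: "Pr ((diag k)\<^sup>2) = Pr (?l\<^sup>2)"
    by (rule m_rcancel[OF w0 Pr_closed Pr_closed Pr_closed, THEN iffD1])
  have split: "(\<Otimes>x\<in>carrier R - {cst x0}. ev x P) = ev (cst 2) P \<otimes> (ev (cst (- 2)) P \<otimes> Pr P)" for P
    unfolding Pr_def S_def by (rule prod_split_two; (rule distinct cst_closed | simp))
  have bij: "bij_betw (\<lambda>x. ev x (diag k)) (carrier R) (carrier R)"
    by (rule inj_self_bij[OF inj]) simp
  have bij': "bij_betw (\<lambda>x. ev x ?l) (carrier R) (carrier R)"
  proof -
    have "inj_on (\<lambda>x. ev x ?l) (carrier R)"
    proof (rule inj_onI)
      fix x y assume x: "x \<in> carrier R" and y: "y \<in> carrier R" and eq: "ev x ?l = ev y ?l"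
      have "cst (- x0) \<oplus> x = cst (- x0) \<oplus> y"
        using eq by (simp only: ev_pCons x y ev_0 r_null r_zero r_one cst_1 one_closed)
      then show "x = y"
        using x y by (metis r_neg1 cst_closed)
    qed
    then show ?thesis
      by (rule inj_self_bij) simp
  qed
  have "(\<Otimes>x\<in>carrier R - {cst x0}. ev x (diag k)) = (\<Otimes>x\<in>carrier R - {cst x0}. ev x ?l)"
    using prod_translate[OF bij cst_closed x0] prod_translate[OF bij' cst_closed, of x0]
      ev_linear_eq_0_iff[of "cst x0" x0] by simp
  moreover have "poly ?l 2 = 2 - x0" "poly ?l (- 2) = - 2 - x0"
    by simp_all
  ultimately have eq: "cst (poly (diag k) 2) \<otimes> (cst (poly (diag k) (- 2)) \<otimes> Pr (diag k))
      = cst (2 - x0) \<otimes> (cst (- 2 - x0) \<otimes> Pr ?l)"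
    unfolding split ev_at_cst by (simp only:)
  define a b where "a = poly (diag k) 2 * poly (diag k) (- 2)" and "b = (2 - x0) * (- 2 - x0)"
  have "cst a \<otimes> Pr (diag k) = cst b \<otimes> Pr ?l"
    using eq unfolding a_def b_def by (simp only: cst_mult m_assoc cst_closed Pr_closed)
  then have "(cst a \<otimes> Pr (diag k)) \<otimes> (cst a \<otimes> Pr (diag k)) = (cst b \<otimes> Pr ?l) \<otimes> (cst b \<otimes> Pr ?l)"
    by simp
  then have "(cst a \<otimes> cst a) \<otimes> (Pr (diag k) \<otimes> Pr (diag k)) = (cst b \<otimes> cst b) \<otimes> (Pr ?l \<otimes> Pr ?l)"
    unfolding mult_interchange[OF cst_closed Pr_closed] .
  then have "cst (a\<^sup>2) \<otimes> Pr (?l\<^sup>2) = cst (b\<^sup>2) \<otimes> Pr (?l\<^sup>2)"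
    using sq by (simp only: power2_eq_square Pr_mult cst_mult)
  moreover have "Pr (?l\<^sup>2) \<noteq> \<zero>"
    using l0 unfolding power2_eq_square Pr_mult by (simp only: integral_iff Pr_closed simp_thms)
  ultimately have "cst (a\<^sup>2) = cst (b\<^sup>2)"
    using m_rcancel[OF _ Pr_closed cst_closed cst_closed] by blast
  moreover have "b\<^sup>2 = (4 - x0\<^sup>2)\<^sup>2"
    by (simp add: b_def power2_eq_square algebra_simps)
  ultimately show ?thesis
    by (simp add: cst_eq_iff a_def)
qed

end

section \<open>Comparison of sizes\<close>

text \<open>
  The index in \<open>{k + 1, k + 2}\<close> that is even is called \<open>2 f\<close>, the odd one \<open>h\<close>.
\<close>

lemma special_values:
  obtains f h :: nat where
    "(k + 1 = 2 * f \<and> k + 2 = h) \<or> (k + 2 = 2 * f \<and> k + 1 = h)" "odd h"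
    "poly (diag k) 2 = int (f * h)" "poly (diag k) (- 2) = int f \<or> poly (diag k) (- 2) = - int f"
    "\<bar>tau k\<bar> = real (h * f\<^sup>2) / 3"
proof (cases "even k")
  case True
  then obtain f where f: "k + 2 = 2 * f"
    by (metis even_add even_numeral evenE)
  then have k: "k = 2 * f - 2" "f \<ge> 1" by simp_all
  have v: "2 * poly (diag k) 2 = 2 * (int f * int (k + 1))" "4 * poly (diag k) (- 2) = 4 * int f"
    using csym_3[of k] csym_minus1[of k] True f by (simp_all add: poly_diag k(1) of_nat_diff k(2) algebra_simps)
  have "tau k = (2 * real f - 1) * (2 * real f) * (4 * real f) / 24"
    using True k by (simp add: tau_def of_nat_diff)
  then have "tau k = real ((k + 1) * f\<^sup>2) / 3"
    using k by (simp add: of_nat_diff power2_eq_square algebra_simps)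
  then have tau: "\<bar>tau k\<bar> = real ((k + 1) * f\<^sup>2) / 3"
    by (simp only: abs_of_nonneg of_nat_0_le_iff divide_nonneg_nonneg zero_le_numeral)
  show thesis
    using f True v by (intro that[OF _ _ _ _ tau]) (simp_all add: algebra_simps)
next
  case False
  then obtain f where f: "k + 1 = 2 * f"
    by (metis even_Suc evenE Suc_eq_plus1)
  then have k: "k = 2 * f - 1" "f \<ge> 1" by simp_all
  have v: "2 * poly (diag k) 2 = 2 * (int f * int (k + 2))" "4 * poly (diag k) (- 2) = - 4 * int f"
    using csym_3[of k] csym_minus1[of k] False f by (simp_all add: poly_diag k(1) of_nat_diff k(2) algebra_simps)
  have "tau k = - ((2 * real f) * (2 * real f + 1) * (4 * real f) / 24)"
    using False k by (simp add: tau_def of_nat_diff)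
  then have "tau k = - (real ((k + 2) * f\<^sup>2) / 3)"
    using k by (simp add: of_nat_diff power2_eq_square algebra_simps)
  then have tau: "\<bar>tau k\<bar> = real ((k + 2) * f\<^sup>2) / 3"
    by (simp only: abs_minus_cancel abs_of_nonneg of_nat_0_le_iff divide_nonneg_nonneg zero_le_numeral)
  show thesis
    using f False v by (intro that[OF _ _ _ _ tau]) (simp_all add: algebra_simps)
qed

context odd_finite_field
begin

lemma not_dvd_small: "p \<ge> 5 \<Longrightarrow> c \<noteq> 0 \<Longrightarrow> \<bar>c\<bar> < 5 \<Longrightarrow> \<not> int p dvd c"
  using dvd_imp_le_int[of c "int p"] by auto

text \<open>
  The cardinality in \<open>torsion_of_unique_zero\<close> is \<open>1\<close>, increased by \<open>1\<close> if \<open>gcd n c\<close> is even and by \<open>1\<close> if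
  it is divisible by \<open>3\<close>.
\<close>

lemma gcd_torus_zero_minus1:
  assumes inj: "inj_on (\<lambda>x. ev x (diag k)) (carrier R)" and x0: "ev (cst (- 1)) (diag k) = \<zero>"
    and n: "n = k + 1 \<or> n = k + 2" and c: "c = q - 1 \<or> c = q + 1" and p: "p \<ge> 5"
  shows "gcd n c \<in> {1, 2, 3}"
proof -
  define d where "d = gcd n c"
  have "d > 0" using n by (auto simp: d_def)
  let ?Z = "{z \<in> {2, - 2, - 1}. int p dvd poly (dickson d) z - 2}"
  let ?Y = "{2} \<union> (if even d then {- 2} else {}) \<union> (if 3 dvd d then {- 1} else {}) :: int set"
  have "?Z \<subseteq> ?Y"
    using not_dvd_small[OF p, of "- 4"] not_dvd_small[OF p, of "- 3"]
    by (auto simp: poly_dickson_minus2 poly_dickson_minus1)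
  then have "card ?Z \<le> card ?Y"
    by (intro card_mono) auto
  moreover have "d < 2 * card ?Z"
    unfolding d_def by (rule torsion_of_unique_zero[OF inj x0 n c])
  ultimately have "d < 2 * card ?Y" by linarith
  moreover have "card ?Y = 1 + of_bool (even d) + of_bool (3 dvd d)"
    by (cases "even d"; cases "3 dvd d") simp_all
  ultimately have "d < 2 * (1 + of_bool (even d) + of_bool (3 dvd d))" by simp
  then have "d \<in> {1, 2, 3}"
    using \<open>d > 0\<close> by (cases "even d"; cases "3 dvd d"; simp; presburger)
  then show ?thesis by (simp only: d_def)
qed

text \<open>
  Here the third point belongs to the torus of \<open>gcd n c\<close> if \<open>4\<close> divides \<open>gcd n c\<close>.
\<close>

lemma gcd_torus_zero_0:
  assumes inj: "inj_on (\<lambda>x. ev x (diag k)) (carrier R)" and x0: "ev (cst 0) (diag k) = \<zero>"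
    and n: "n = k + 1 \<or> n = k + 2" and c: "c = q - 1 \<or> c = q + 1" and p: "p \<ge> 5"
  shows "gcd n c \<in> {1, 2, 4}"
proof -
  define d where "d = gcd n c"
  have "d > 0" using n by (auto simp: d_def)
  let ?Z = "{z \<in> {2, - 2, 0}. int p dvd poly (dickson d) z - 2}"
  let ?Y = "{2} \<union> (if even d then {- 2} else {}) \<union> (if 4 dvd d then {0} else {}) :: int set"
  have "?Z \<subseteq> ?Y"
    using not_dvd_small[OF p, of "- 4"] not_dvd_small[OF p, of "- 2"]
    by (auto simp: poly_dickson_minus2 poly_dickson_0)
  then have "card ?Z \<le> card ?Y"
    by (intro card_mono) auto
  moreover have "d < 2 * card ?Z"
    unfolding d_def by (rule torsion_of_unique_zero[OF inj x0 n c])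
  ultimately have "d < 2 * card ?Y" by linarith
  moreover have "card ?Y = 1 + of_bool (even d) + of_bool (4 dvd d)"
    by (cases "even d"; cases "4 dvd d") simp_all
  ultimately have "d < 2 * (1 + of_bool (even d) + of_bool (4 dvd d))" by simp
  then have "d \<in> {1, 2, 4}"
    using \<open>d > 0\<close> by (cases "even d"; cases "4 dvd d"; simp; presburger)
  then show ?thesis by (simp only: d_def)
qed

lemma gcd_period: "gcd n period = lcm (gcd n (q - 1)) (gcd n (q + 1))"
  by (simp add: period_def gcd_lcm_distrib)

lemma four_dvd: "4 dvd q - 1 \<or> 4 dvd q + 1"
  using odd_q by presburger

lemma three_dvd:
  assumes "p \<ge> 5"
  shows "3 dvd q - 1 \<or> 3 dvd q + 1"
proof -
  have "\<not> 3 dvd p"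
    using prime_p assms by (auto simp: prime_nat_iff)
  then have "\<not> 3 dvd q"
    unfolding q_def using prime_dvd_power[of 3 p m] by auto
  then show ?thesis
    by presburger
qed

text \<open>
  Put \<open>T = h f\<^sup>2 = 3 \<bar>\<tau>(k)\<bar>\<close>. For an injective diagonal map, \<open>values_at_special_points\<close> says that \<open>p\<close> divides
  \<open>T\<^sup>2 - 9\<close> if \<open>x0 = -1\<close> and \<open>T\<^sup>2 - 16\<close> if \<open>x0 = 0\<close>. In the first case \<open>T = 3 s\<close> and \<open>p\<close> divides \<open>s - 1\<close> or \<open>s + 1\<close>; since
  \<open>p\<close> is at least \<open>s + 1\<close>, equality holds, and then \<open>f\<close> divides \<open>p - 1\<close>, contrary to
  \<open>gcd (2 f) (q - 1) = 2\<close>. In the second case \<open>T = 4 s\<close> and the bound \<open>p \<le> s + 1\<close> alone is contradictory.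
\<close>

lemma diag_not_injective:
  assumes k: "k > 1"
    and parity: "(k + 1 = 2 * f \<and> k + 2 = h) \<or> (k + 2 = 2 * f \<and> k + 1 = h)" and "odd h"
    and a: "poly (diag k) 2 = int (f * h)"
    and b: "poly (diag k) (- 2) = int f \<or> poly (diag k) (- 2) = - int f"
    and bound: "h * f\<^sup>2 + 3 \<le> 3 * p"
  shows "\<not> inj_on (\<lambda>x. ev x (diag k)) (carrier R)"
proof
  assume inj: "inj_on (\<lambda>x. ev x (diag k)) (carrier R)"
  have f: "f \<ge> 2" and h: "h \<ge> 3"
    using k parity \<open>odd h\<close> by presburger+
  have f2: "f\<^sup>2 \<ge> 2 * f" "f\<^sup>2 \<ge> 4"
    using f power_mono[of 2 f 2] by (simp_all add: power2_eq_square)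
  have hf: "h * f\<^sup>2 \<ge> h * 4" "h * f\<^sup>2 \<ge> 3 * f\<^sup>2"
    using f2 h by (intro mult_le_mono; simp)+
  have p5: "p \<ge> 5"
    using hf h bound by linarith
  have "\<not> p dvd h"
    using dvd_imp_le[of p h] hf h bound by linarith
  moreover have "\<not> p dvd f"
    using dvd_imp_le[of p f] hf f f2 bound by linarith
  ultimately have "\<not> int p dvd int (f * h)" "\<not> int p dvd int f"
    using prime_p by (simp_all only: int_dvd_int_iff prime_dvd_mult_iff simp_thms)
  then have "ev (cst 2) (diag k) \<noteq> \<zero>" "ev (cst (- 2)) (diag k) \<noteq> \<zero>"
    using b unfolding ev_at_cst cst_eq_0_iff a by auto
  from unique_zero[OF inj this] obtain x0 where x0: "x0 = - 1 \<or> x0 = 0" "ev (cst x0) (diag k) = \<zero>"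
    by blast
  have distinct: "cst 2 \<noteq> cst (- 2)" "cst x0 \<noteq> cst 2" "cst x0 \<noteq> cst (- 2)"
    unfolding cst_eq_iff using x0(1) p5 not_dvd_small[OF p5, of 4] not_dvd_small[OF p5, of 3]
      not_dvd_small[OF p5, of 2] by auto
  have torus: "cst x0 \<in> torus (2 * f) \<union> torus h"
    using diag_eq_0_iff[OF cst_closed distinct(2,3), of k] x0(2) parity by auto
  have n: "2 * f = k + 1 \<or> 2 * f = k + 2" "h = k + 1 \<or> h = k + 2"
    using parity by auto
  have prime_int_p: "prime (int p)"
    using prime_p by simp
  have period4: "4 dvd period"
    using four_dvd by (auto simp: period_def)
  have even_gcd: "even (gcd (2 * f) (q - 1))" "even (gcd (2 * f) (q + 1))"
    using odd_q by simp_all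
  have odd_gcd: "odd (gcd h c)" for c
    using \<open>odd h\<close> by simp
  have square: "(poly (diag k) 2 * poly (diag k) (- 2))\<^sup>2 = (int (h * f\<^sup>2))\<^sup>2"
    using b unfolding a by (auto simp: power2_eq_square)
  have special: "int p dvd (int (h * f\<^sup>2))\<^sup>2 - (4 - x0\<^sup>2)\<^sup>2"
    if gh: "gcd h period = d" and gf: "gcd (2 * f) period = e"
      and fixed: "\<And>u. coprime u period \<Longrightarrow> poly (dickson u) x0 = x0"
      and factors: "(dickson d - 2) * (dickson e - 2) = [:- x0, 1:]\<^sup>2 * (([:0, 1:] - 2) * ([:0, 1:]\<^sup>2 - 4))" for d e
  proof -
    have "(dickson (gcd (k + 1) period) - 2) * (dickson (gcd (k + 2) period) - 2) = (dickson d - 2) * (dickson e - 2)"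
      using parity
    proof
      assume "k + 1 = 2 * f \<and> k + 2 = h"
      then show ?thesis using gh gf by (simp only: mult.commute)
    next
      assume "k + 2 = 2 * f \<and> k + 1 = h"
      then show ?thesis using gh gf by (simp only:)
    qed
    from values_at_special_points[OF inj x0(2) distinct fixed this[unfolded factors]]
    show ?thesis unfolding square .
  qed
  from x0(1) show False
  proof
    assume x0_eq: "x0 = - 1"
    have z: "ev (cst (- 1)) (diag k) = \<zero>"
      using x0(2) x0_eq by simp
    have "3 dvd 2 * f \<or> 3 dvd h"
    proof (rule ccontr)
      assume "\<not> (3 dvd 2 * f \<or> 3 dvd h)"
      then have "int p dvd - 3"
        using torus unfolding x0_eq torus_def Un_iff mem_Collect_eq ev_at_cst cst_eq_iff poly_dickson_minus1
        by simp
      then show False using not_dvd_small[OF p5, of "- 3"] by simp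
    qed
    have G: "gcd (2 * f) (q - 1) \<in> {1, 2, 3}" "gcd (2 * f) (q + 1) \<in> {1, 2, 3}"
      "gcd h (q - 1) \<in> {1, 2, 3}" "gcd h (q + 1) \<in> {1, 2, 3}"
      using gcd_torus_zero_minus1[OF inj z n(1) disjI1[OF refl] p5]
        gcd_torus_zero_minus1[OF inj z n(1) disjI2[OF refl] p5]
        gcd_torus_zero_minus1[OF inj z n(2) disjI1[OF refl] p5]
        gcd_torus_zero_minus1[OF inj z n(2) disjI2[OF refl] p5] by this+
    have ev2: "c = 2" if "c \<in> {1, 2, 3}" "even c" for c :: nat
      using that by auto
    have od: "c \<in> {1, 3}" if "c \<in> {1, 2, 3}" "odd c" for c :: nat
      using that by auto
    have g: "gcd (2 * f) (q - 1) = 2" "gcd (2 * f) (q + 1) = 2"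
      "gcd h (q - 1) \<in> {1, 3}" "gcd h (q + 1) \<in> {1, 3}"
      by (rule ev2[OF G(1) even_gcd(1)] ev2[OF G(2) even_gcd(2)] od[OF G(3) odd_gcd] od[OF G(4) odd_gcd])+
    have "\<not> 3 dvd 2 * f"
    proof
      assume "3 dvd 2 * f"
      then have "3 dvd gcd (2 * f) (q - 1) \<or> 3 dvd gcd (2 * f) (q + 1)"
        using three_dvd[OF p5] by (metis gcd_greatest)
      then show False unfolding g by simp
    qed
    then have "3 dvd h"
      using \<open>3 dvd 2 * f \<or> 3 dvd h\<close> by blast
    have period3: "3 dvd period"
      using three_dvd[OF p5] unfolding period_def by (metis dvd_lcmI1 dvd_lcmI2)
    have G3: "3 dvd gcd h period"
      using \<open>3 dvd h\<close> period3 by (rule gcd_greatest)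
    have G13: "gcd h period \<in> {1, 3}"
      unfolding gcd_period using g(3,4) by auto
    have "c = 3" if "3 dvd c" "c \<in> {1, 3}" for c :: nat
      using that by auto
    from this[OF G3 G13] have gh: "gcd h period = 3" .
    have gf: "gcd (2 * f) period = 2"
      unfolding gcd_period g by simp
    have "poly (dickson u) x0 = x0" if "coprime u period" for u
      using coprime_common_divisor_nat[OF that, of 3] period3 by (auto simp: x0_eq poly_dickson_minus1)
    moreover have "(dickson 3 - 2) * (dickson 2 - 2) = [:- x0, 1:]\<^sup>2 * (([:0, 1:] - 2) * ([:0, 1:]\<^sup>2 - 4))"
    proof -
      have "dickson 3 = [:0, 1:] * dickson 2 - dickson 1"
        by (simp add: numeral_3_eq_3 numeral_2_eq_2 dickson.simps(3))
      then show ?thesis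
        by (simp add: dickson_2 x0_eq power2_eq_square numeral_poly)
    qed
    ultimately have dvd: "int p dvd (int (h * f\<^sup>2))\<^sup>2 - (4 - x0\<^sup>2)\<^sup>2"
      by (intro special[OF gh gf])
    obtain h' where h': "h = 3 * h'" using \<open>3 dvd h\<close> by blast
    define s where "s = h' * f\<^sup>2"
    have s: "h * f\<^sup>2 = 3 * s" by (simp add: s_def h')
    have "(int (h * f\<^sup>2))\<^sup>2 - (4 - x0\<^sup>2)\<^sup>2 = 3 * (3 * ((int s - 1) * (int s + 1)))"
      unfolding s x0_eq by (simp add: power2_eq_square algebra_simps)
    with dvd have "int p dvd 3 * (3 * ((int s - 1) * (int s + 1)))"
      by (simp only:)
    moreover have "\<not> int p dvd 3"
      by (rule not_dvd_small[OF p5]) simp_all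
    ultimately have "int p dvd int s - 1 \<or> int p dvd int s + 1"
      unfolding prime_dvd_mult_iff[OF prime_int_p] by blast
    moreover have "s \<ge> 4" "s + 1 \<le> p"
      using hf(1) h s bound f2(2) by linarith+
    ultimately have "p = s + 1"
      using dvd_imp_le_int[of "int s - 1" "int p"] dvd_imp_le_int[of "int s + 1" "int p"] by linarith
    then have "f dvd p - 1"
      by (simp add: s_def power2_eq_square)
    also have "p - 1 dvd q - 1"
    proof -
      have "1 + (p - 1) = p" using p5 by simp
      moreover have "[1 + (p - 1) = 1] (mod (p - 1))"
        by (simp only: cong_def mod_add_self2)
      ultimately have "[p ^ m = 1 ^ m] (mod (p - 1))"
        by (metis cong_pow)
      then have "[q = 1] (mod (p - 1))"
        by (simp only: q_def power_one)
      then show ?thesis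
        by (rule cong_to_1_nat)
    qed
    finally have "f dvd gcd (2 * f) (q - 1)" by simp
    then have "f = 2"
      using f dvd_imp_le[of f 2] unfolding g by simp
    then have "4 dvd gcd (2 * f) period"
      using period4 by simp
    then show False
      unfolding gf by simp
  next
    assume x0_eq: "x0 = 0"
    have z: "ev (cst 0) (diag k) = \<zero>"
      using x0(2) x0_eq by simp
    have "4 dvd 2 * f"
    proof (rule ccontr)
      assume "\<not> 4 dvd 2 * f"
      then have "int p dvd - 4 \<or> int p dvd - 2"
        using torus \<open>odd h\<close> unfolding x0_eq torus_def Un_iff mem_Collect_eq ev_at_cst cst_eq_iff poly_dickson_0
        by auto
      then show False using not_dvd_small[OF p5, of "- 4"] not_dvd_small[OF p5, of "- 2"] by auto
    qed
    have G: "gcd (2 * f) (q - 1) \<in> {1, 2, 4}" "gcd (2 * f) (q + 1) \<in> {1, 2, 4}"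
      "gcd h (q - 1) \<in> {1, 2, 4}" "gcd h (q + 1) \<in> {1, 2, 4}"
      using gcd_torus_zero_0[OF inj z n(1) disjI1[OF refl] p5]
        gcd_torus_zero_0[OF inj z n(1) disjI2[OF refl] p5]
        gcd_torus_zero_0[OF inj z n(2) disjI1[OF refl] p5]
        gcd_torus_zero_0[OF inj z n(2) disjI2[OF refl] p5] by this+
    have ev2: "c \<in> {2, 4}" if "c \<in> {1, 2, 4}" "even c" for c :: nat
      using that by auto
    have od: "c = 1" if "c \<in> {1, 2, 4}" "odd c" for c :: nat
      using that by auto
    have g: "gcd (2 * f) (q - 1) \<in> {2, 4}" "gcd (2 * f) (q + 1) \<in> {2, 4}"
      "gcd h (q - 1) = 1" "gcd h (q + 1) = 1"
      by (rule ev2[OF G(1) even_gcd(1)] ev2[OF G(2) even_gcd(2)] od[OF G(3) odd_gcd] od[OF G(4) odd_gcd])+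
    have gh: "gcd h period = 1"
      unfolding gcd_period g by simp
    have G4: "4 dvd gcd (2 * f) period"
      using \<open>4 dvd 2 * f\<close> period4 by (rule gcd_greatest)
    have G24: "gcd (2 * f) period \<in> {2, 4}"
      unfolding gcd_period using g(1,2) by (auto simp: lcm_nat_def)
    have "c = 4" if "4 dvd c" "c \<in> {2, 4}" for c :: nat
      using that by auto
    from this[OF G4 G24] have gf: "gcd (2 * f) period = 4" .
    have "poly (dickson u) x0 = x0" if "coprime u period" for u
      using coprime_common_divisor_nat[OF that, of 2] even_period by (auto simp: x0_eq poly_dickson_0)
    moreover have "(dickson 1 - 2) * (dickson 4 - 2) = [:- x0, 1:]\<^sup>2 * (([:0, 1:] - 2) * ([:0, 1:]\<^sup>2 - 4))"
    proof -
      have "dickson 4 = [:0, 1:] * ([:0, 1:] * dickson 2 - dickson 1) - dickson 2"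
        by (simp add: numeral_eq_Suc dickson.simps(3))
      then show ?thesis
        by (simp add: dickson_2 x0_eq power2_eq_square numeral_poly)
    qed
    ultimately have dvd: "int p dvd (int (h * f\<^sup>2))\<^sup>2 - (4 - x0\<^sup>2)\<^sup>2"
      by (intro special[OF gh gf])
    obtain g where g: "f = 2 * g" using \<open>4 dvd 2 * f\<close> by (elim dvdE) simp
    define s where "s = h * g\<^sup>2"
    have s: "h * f\<^sup>2 = 4 * s" by (simp add: s_def g power2_eq_square)
    have "(int (h * f\<^sup>2))\<^sup>2 - (4 - x0\<^sup>2)\<^sup>2 = 4 * (4 * ((int s - 1) * (int s + 1)))"
      unfolding s x0_eq by (simp add: power2_eq_square algebra_simps)
    with dvd have "int p dvd 4 * (4 * ((int s - 1) * (int s + 1)))"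
      by (simp only:)
    moreover have "\<not> int p dvd 4"
      by (rule not_dvd_small[OF p5]) simp_all
    ultimately have "int p dvd int s - 1 \<or> int p dvd int s + 1"
      unfolding prime_dvd_mult_iff[OF prime_int_p] by blast
    moreover have "s \<ge> 3" "4 * s + 3 \<le> 3 * p"
      using hf(1) h s bound by linarith+
    ultimately show False
      using dvd_imp_le_int[of "int s - 1" "int p"] dvd_imp_le_int[of "int s + 1" "int p"] by linarith
  qed
qed

end

lemma induced_map_diagonal:
  assumes "cring R" "x \<in> carrier R"
  shows "induced_map R (Q_A2 k) (int_eval R x [:1, 1:], int_eval R x [:1, 1:])
    = (int_eval R x (diag k), int_eval R x (diag k))"
proof -
  interpret cring R by fact
  show ?thesis
    using assms(2)
    by (simp add: induced_map_def Q_A2_eq ev_bipoly_eval bipoly_eval_csym bipoly_eval_var diag_def)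
qed

text \<open>
  The diagonal is mapped to itself, so a permutation of the plane is injective on it.
\<close>

lemma permutes_plane_bound:
  assumes "k > 1" and "prime p" "odd p" "m \<ge> 1" "field F" "order F = p ^ m"
    and perm: "permutes_plane F (Q_A2 k)"
  shows "real p < \<bar>tau k\<bar> + 1"
proof (rule ccontr)
  assume neg: "\<not> real p < \<bar>tau k\<bar> + 1"
  interpret odd_finite_field F p m
    using assms by (intro odd_finite_field.intro odd_finite_field_axioms.intro)
  obtain f h :: nat where fh:
    "(k + 1 = 2 * f \<and> k + 2 = h) \<or> (k + 2 = 2 * f \<and> k + 1 = h)" "odd h"
    "poly (diag k) 2 = int (f * h)" "poly (diag k) (- 2) = int f \<or> poly (diag k) (- 2) = - int f"
    "\<bar>tau k\<bar> = real (h * f\<^sup>2) / 3"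
    by (rule special_values)
  have "real (h * f\<^sup>2 + 3) \<le> real (3 * p)"
    using neg unfolding fh(5) by simp
  then have "h * f\<^sup>2 + 3 \<le> 3 * p"
    by (simp only: of_nat_le_iff)
  from diag_not_injective[OF assms(1) fh(1-4) this]
  have "\<not> inj_on (\<lambda>x. ev x (diag k)) (carrier F)" .
  moreover have "inj_on (\<lambda>x. ev x (diag k)) (carrier F)"
  proof (rule inj_onI)
    fix x y assume x: "x \<in> carrier F" and y: "y \<in> carrier F" and eq: "ev x (diag k) = ev y (diag k)"
    have "induced_map F (Q_A2 k) (ev x [:1, 1:], ev x [:1, 1:]) =
        induced_map F (Q_A2 k) (ev y [:1, 1:], ev y [:1, 1:])"
      using induced_map_diagonal[OF is_cring x] induced_map_diagonal[OF is_cring y] eq by simp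
    then have "ev x [:1, 1:] = ev y [:1, 1:]"
      using perm x y unfolding permutes_plane_def bij_betw_def by (auto dest!: inj_onD)
    then have "\<one>\<^bsub>F\<^esub> \<oplus>\<^bsub>F\<^esub> x = \<one>\<^bsub>F\<^esub> \<oplus>\<^bsub>F\<^esub> y"
      by (simp only: ev_pCons x y ev_0 r_null r_zero r_one cst_1 one_closed)
    then show "x = y"
      using x y by (metis r_neg1 one_closed)
  qed
  ultimately show False by blast
qed

theorem theorem24:
  fixes k :: nat
  assumes "k > 1"
  shows "(\<forall>(p::nat) (m::nat) (q::nat) (F :: ('a, 'b) ring_scheme).
            prime p \<and> odd p \<and> m \<ge> 1 \<and> q = p ^ m \<and> field F \<and> order F = q \<and>
            permutes_plane F (Q_A2 k) \<longrightarrow> real p < \<bar>tau k\<bar> + 1)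
         \<and> \<not> arithmetically_exceptional (Q_A2 k)"
proof
  show "\<forall>(p::nat) (m::nat) (q::nat) (F :: ('a, 'b) ring_scheme).
            prime p \<and> odd p \<and> m \<ge> 1 \<and> q = p ^ m \<and> field F \<and> order F = q \<and>
            permutes_plane F (Q_A2 k) \<longrightarrow> real p < \<bar>tau k\<bar> + 1"
    using permutes_plane_bound[OF assms] by blast
  \<comment> \<open>The summand \<open>3\<close> accounts for \<open>p = 2\<close>.\<close>
  have "p < nat \<lceil>\<bar>tau k\<bar> + 1\<rceil> + 3" if p: "prime p" "permutes_plane (residue_ring (int p)) (Q_A2 k)" for p
  proof (cases "p = 2")
    case False
    then have "odd p" using p(1) prime_odd_nat prime_ge_2_nat[of p] by force
    interpret residues_prime p "residue_ring (int p)"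
      using p(1) by (simp add: residues_prime_def)
    have "field (residue_ring (int p))" by (rule is_field)
    moreover have "order (residue_ring (int p)) = p ^ 1"
      using prime_gt_0_nat[OF p(1)] by (simp add: order_def residue_ring_def)
    ultimately have "real p < \<bar>tau k\<bar> + 1"
      using permutes_plane_bound[OF assms p(1) \<open>odd p\<close>, of 1] p(2) by blast
    then show ?thesis by linarith
  qed simp
  then have "{p. prime p \<and> permutes_plane (residue_ring (int p)) (Q_A2 k)} \<subseteq> {..<nat \<lceil>\<bar>tau k\<bar> + 1\<rceil> + 3}"
    by auto
  then show "\<not> arithmetically_exceptional (Q_A2 k)"
    unfolding arithmetically_exceptional_def using finite_subset by blast
qed

end
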